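(* Let $J:\mathbb{R}\to[0,\infty)$ be smooth, radially symmetric (even), with $\int_{\mathbb{R}}J=1$ and supported in $(-d,d)$, $d>0$. Let $u_0\ge0$ be bounded, with $u_0=0$ for $x<0$ and $\int_0^\infty u_0(x)(1+x)\,dx<\infty$. Let $u$ be the solution to $$u_t=J*u-u\ \ (x\ge0,\ t>0),\qquad u(x,t)=0\ \ (x<0,\ t>0),\qquad u(x,0)=u_0(x)\ \ (x\in\mathbb{R}).$$ Then, as $t\to\infty$, $$M_1(t)=\int_0^\infty u(x,t)\,x\,dx\ \to\ M_1^*:=\int_0^\infty u_0(x)\phi(x)\,dx.$$
   Context: $\mathbb{R}_+=(0,\infty)$; convolution is in the space variable $x$. "Supported in $(-d,d)$" means $J(z)=0$ for $|z|\ge d$. $\phi:(-d,\infty)\to\mathbb{R}$ is the unique solution to the stationary problem $J*\phi=\phi$ for $x\ge0$, $\phi=0$ for $-d<x<0$, $(\phi(x)-x)\in L^\infty(\mathbb{R}_+)$. The solution $u$ is the unique solution in $C([0,\infty);L^1(\mathbb{R}_+,(1+x)\,dx))$. *)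

theory Defs
  imports "HOL-Analysis.Analysis"
begin

definition smooth_real :: "(real \<Rightarrow> real) \<Rightarrow> bool" where
  "smooth_real f \<longleftrightarrow> (\<forall>n. (deriv ^^ n) f differentiable_on UNIV)"

definition conv :: "(real \<Rightarrow> real) \<Rightarrow> (real \<Rightarrow> real) \<Rightarrow> real \<Rightarrow> real" where
  "conv J f x = (LINT y|lebesgue. J (x - y) * f y)"

text \<open>The half line \<open>(0,\<infinity>)\<close> with Lebesgue measure, and the space \<open>L\<^sup>1((0,\<infinity>), (1+x) dx)\<close>.\<close>

abbreviation half_line :: "real measure" where
  "half_line \<equiv> lebesgue_on {0<..}"

definition in_weighted_L1 :: "(real \<Rightarrow> real) \<Rightarrow> bool" where
  "in_weighted_L1 f \<longleftrightarrow> integrable half_line (\<lambda>x. f x * (1 + x))"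

definition weighted_L1_norm :: "(real \<Rightarrow> real) \<Rightarrow> real" where
  "weighted_L1_norm f = (LINT x|half_line. \<bar>f x\<bar> * (1 + x))"

definition in_Linf :: "(real \<Rightarrow> real) \<Rightarrow> bool" where
  "in_Linf f \<longleftrightarrow> f \<in> borel_measurable half_line \<and> (\<exists>C. AE x in half_line. \<bar>f x\<bar> \<le> C)"

text \<open>Membership in \<open>C([0,\<infinity>); L\<^sup>1((0,\<infinity>), (1+x) dx))\<close> of the curve \<open>t \<mapsto> u(\<cdot>,t)\<close>;
  values of \<open>u\<close> at negative times play no role.\<close>

definition continuous_weighted_L1 :: "(real \<Rightarrow> real \<Rightarrow> real) \<Rightarrow> bool" where
  "continuous_weighted_L1 u \<longleftrightarrow>
     (\<forall>t\<ge>0. in_weighted_L1 (\<lambda>x. u x t)) \<and>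
     (\<forall>s\<ge>0. ((\<lambda>t. weighted_L1_norm (\<lambda>x. u x t - u x s)) \<longlongrightarrow> 0) (at s within {0..}))"

text \<open>Since solutions are curves in an \<open>L\<^sup>1\<close> space, the equations are only required for almost
  every \<open>x\<close>, with an exceptional null set not depending on \<open>t\<close>.  The time derivative is classical.\<close>

definition evolution_solution ::
    "(real \<Rightarrow> real) \<Rightarrow> (real \<Rightarrow> real) \<Rightarrow> (real \<Rightarrow> real \<Rightarrow> real) \<Rightarrow> bool" where
  "evolution_solution J u0 u \<longleftrightarrow>
     continuous_weighted_L1 u \<and>
     (AE x in lebesgue. x \<ge> 0 \<longrightarrow>
        (\<forall>t>0. (u x has_real_derivative (conv J (\<lambda>y. u y t) x - u x t)) (at t))) \<and>
     (AE x in lebesgue. x < 0 \<longrightarrow> (\<forall>t>0. u x t = 0)) \<and>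
     (AE x in lebesgue. u x 0 = u0 x)"

text \<open>A function \<open>\<phi>\<close> on \<open>(-d,\<infinity>)\<close> is represented by a total function.  Its values on
  \<open>(-\<infinity>,-d]\<close> are irrelevant: if \<open>J\<close> vanishes outside \<open>(-d,d)\<close> and \<open>x \<ge> 0\<close>, then
  \<open>J (x - y) = 0\<close> for all \<open>y \<le> -d\<close>.\<close>

definition stationary_solution :: "(real \<Rightarrow> real) \<Rightarrow> real \<Rightarrow> (real \<Rightarrow> real) \<Rightarrow> bool" where
  "stationary_solution J d \<phi> \<longleftrightarrow>
     (\<forall>x\<ge>0. conv J \<phi> x = \<phi> x) \<and>
     (\<forall>x. -d < x \<and> x < 0 \<longrightarrow> \<phi> x = 0) \<and>
     in_Linf (\<lambda>x. \<phi> x - x)"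

end

theory Submission
  imports Defs
begin

text \<open>The stationary solution \<open>\<phi>\<close> is a harmonic function for convolution with \<open>J\<close> on the half line,
  and this convolution is symmetric because \<open>J\<close> is even.  Hence \<open>\<integral> u \<phi>\<close> is conserved and stays equal
  to \<open>\<integral> u\<^sub>0 \<phi>\<close> (\<open>harmonic_pairing_constant\<close>).  Since \<open>\<phi>(x) - x\<close> is bounded, the first moment of \<open>u\<close>
  differs from this constant by at most a multiple of \<open>\<integral> \<bar>u\<bar>\<close>, and the theorem reduces to the decay
  of the mass \<open>\<integral> \<bar>u\<bar>\<close> to zero (\<open>mass_tendsto_0\<close>).

  The decay is proved with Lyapunov functions.  If \<open>\<psi> \<ge> 0\<close> is a supersolution, that is, if its
  convolution over the half line is at most \<open>\<psi>\<close>, then \<open>\<integral> \<bar>u\<bar> \<psi>\<close> decreases, and it does so at least at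
  the rate \<open>\<integral> \<bar>u\<bar> (\<psi> - J * \<psi>)\<close> (\<open>supersolution_pairing_decay\<close>).  The constant 1 shows that the
  mass decreases, and \<open>x + d\<close> that the first moment of \<open>\<bar>u\<bar>\<close> remains bounded, so that little mass
  can be far away.  A truncated parabola is strictly superharmonic on a given interval \<open>(0, R)\<close>; its
  pairing with \<open>\<bar>u\<bar>\<close> is nonnegative and cannot decrease at a fixed rate forever, and therefore mass
  cannot remain in the interval either.

  These computations need the differential equation in the norm of the weighted space, whereas a
  solution satisfies it pointwise for almost every \<open>x\<close>.  The passage is made by
  \<open>L1_mean_value_inequality\<close>, with Riemann sums in time and Fatou's lemma, and leads to
  \<open>euler_step\<close>: over short times the curve agrees with an explicit Euler step up to an error that is
  a small multiple of the time step.  All the monotonicity and conservation laws are read off from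
  Euler steps and then globalized by a compactness argument in time
  (\<open>increment_bound_from_local\<close>).\<close>

section \<open>Increments of curves in \<open>L\<^sup>1\<close>\<close>

text \<open>On each piece of the partition the mean value theorem gives the exact increment, and uniform
  continuity of the derivative bounds the cost of evaluating it at the left end point instead.\<close>

lemma left_Riemann_sums_tendsto:
  fixes g g' :: "real \<Rightarrow> real"
  assumes "a < b"
    and der: "\<And>r. a \<le> r \<Longrightarrow> r \<le> b \<Longrightarrow> (g has_real_derivative g' r) (at r)"
    and cont: "continuous_on {a..b} g'"
  shows "(\<lambda>n. (b - a) / Suc n * (\<Sum>i<Suc n. g' (a + i * ((b - a) / Suc n)))) \<longlonglongrightarrow> g b - g a"
proof (rule LIMSEQ_I)
  fix e :: real
  assume "e > 0"
  define \<epsilon> where "\<epsilon> = e / (2 * (b - a))"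
  have "\<epsilon> > 0"
    using \<open>e > 0\<close> \<open>a < b\<close> by (simp add: \<epsilon>_def)
  have "uniformly_continuous_on {a..b} g'"
    using cont by (simp add: compact_uniformly_continuous)
  then obtain \<delta> where "\<delta> > 0" and
    \<delta>: "\<And>x y. x \<in> {a..b} \<Longrightarrow> y \<in> {a..b} \<Longrightarrow> dist y x < \<delta> \<Longrightarrow> dist (g' y) (g' x) < \<epsilon>"
    unfolding uniformly_continuous_on_def using \<open>\<epsilon> > 0\<close> by metis
  obtain n0 :: nat where n0: "(b - a) / \<delta> < real n0"
    using reals_Archimedean2 by blast
  show "\<exists>no. \<forall>n\<ge>no. norm ((b - a) / Suc n * (\<Sum>i<Suc n. g' (a + i * ((b - a) / Suc n))) - (g b - g a)) < e"
  proof (intro exI allI impI)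
    fix n
    assume "n \<ge> n0"
    define s where "s = (b - a) / Suc n"
    define p where "p i = a + real i * s" for i :: nat
    have "s > 0"
      using \<open>a < b\<close> by (simp add: s_def)
    have total: "Suc n * s = b - a"
      by (simp add: s_def)
    have "(b - a) / \<delta> < Suc n"
      using n0 \<open>n \<ge> n0\<close> by linarith
    then have "s < \<delta>"
      using \<open>\<delta> > 0\<close> by (simp add: s_def field_simps)
    have p_in: "p i \<in> {a..b}" if "i \<le> Suc n" for i
    proof -
      have "real i * s \<le> real (Suc n) * s"
        using that \<open>s > 0\<close> by (intro mult_right_mono) auto
      then show ?thesis
        using total \<open>s > 0\<close> by (auto simp: p_def simp del: of_nat_Suc)
    qed
    have step: "\<bar>s * g' (p i) - (g (p (Suc i)) - g (p i))\<bar> \<le> s * \<epsilon>" if "i < Suc n" for i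
    proof -
      have p_Suc: "p (Suc i) = p i + s"
        by (simp add: p_def algebra_simps)
      have in1: "p i \<in> {a..b}" and in2: "p i + s \<in> {a..b}"
        using p_in[of i] p_in[of "Suc i"] that p_Suc by auto
      have "\<exists>z>p i. z < p i + s \<and> g (p i + s) - g (p i) = (p i + s - p i) * g' z"
        using \<open>s > 0\<close> in1 in2 by (intro MVT2) (auto intro!: der)
      then obtain z where z: "p i < z" "z < p i + s" "g (p i + s) - g (p i) = s * g' z"
        by auto
      have "dist (g' z) (g' (p i)) < \<epsilon>"
        using z in1 in2 \<open>s < \<delta>\<close> by (intro \<delta>) (auto simp: dist_real_def)
      then have "s * \<bar>g' (p i) - g' z\<bar> \<le> s * \<epsilon>"
        using \<open>s > 0\<close> by (intro mult_left_mono) (auto simp: dist_real_def)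
      moreover have "s * g' (p i) - (g (p (Suc i)) - g (p i)) = s * (g' (p i) - g' z)"
        using z(3) p_Suc by (simp add: algebra_simps)
      ultimately show ?thesis
        using \<open>s > 0\<close> by (simp add: abs_mult)
    qed
    have "(\<Sum>i<Suc n. g (p (Suc i)) - g (p i)) = g (p (Suc n)) - g (p 0)"
      by (rule sum_lessThan_telescope)
    moreover have "p (Suc n) = b" "p 0 = a"
      using total by (auto simp: p_def)
    ultimately have "s * (\<Sum>i<Suc n. g' (p i)) - (g b - g a)
        = (\<Sum>i<Suc n. s * g' (p i) - (g (p (Suc i)) - g (p i)))"
      by (simp add: sum_subtractf sum_distrib_left del: sum.lessThan_Suc)
    also have "\<bar>\<dots>\<bar> \<le> (\<Sum>i<Suc n. s * \<epsilon>)"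
      by (rule order_trans[OF sum_abs sum_mono]) (use step in auto)
    also have "\<dots> = (b - a) * \<epsilon>"
      using total by (simp del: sum.lessThan_Suc of_nat_Suc)
    also have "\<dots> < e"
      using \<open>e > 0\<close> \<open>a < b\<close> by (simp add: \<epsilon>_def field_simps)
    finally show "norm ((b - a) / Suc n * (\<Sum>i<Suc n. g' (a + i * ((b - a) / Suc n))) - (g b - g a)) < e"
      by (simp add: p_def s_def del: sum.lessThan_Suc of_nat_Suc)
  qed
qed

text \<open>For almost every \<open>x\<close> the increment is a limit of Riemann sums, each of norm at most
  \<open>(b - a) * B\<close>, and Fatou's lemma passes this bound to the limit.  Sums over finitely many
  times take the place of an integral over time, so that \<open>w'\<close> is never integrated in both
  variables.\<close>

lemma L1_mean_value_inequality:
  fixes w w' :: "'a \<Rightarrow> real \<Rightarrow> real"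
  assumes "a < b"
    and der: "AE x in M. \<forall>r\<in>{a..b}. (w x has_real_derivative w' x r) (at r)"
    and cont: "AE x in M. continuous_on {a..b} (w' x)"
    and int: "integrable M (\<lambda>x. w x b - w x a)"
    and int': "\<And>r. r \<in> {a..b} \<Longrightarrow> integrable M (\<lambda>x. w' x r)"
    and bound: "\<And>r. r \<in> {a..b} \<Longrightarrow> (LINT x|M. \<bar>w' x r\<bar>) \<le> B"
  shows "(LINT x|M. \<bar>w x b - w x a\<bar>) \<le> (b - a) * B"
proof -
  define p where "p n i = a + real i * ((b - a) / Suc n)" for n i :: nat
  define S where "S n x = (b - a) / Suc n * (\<Sum>i<Suc n. w' x (p n i))" for n x
  have p_in: "p n i \<in> {a..b}" if "i < Suc n" for n i
  proof -
    have "real i * ((b - a) / Suc n) \<le> real (Suc n) * ((b - a) / Suc n)"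
      using that \<open>a < b\<close> by (intro mult_right_mono) auto
    then show ?thesis
      using \<open>a < b\<close> by (auto simp: p_def)
  qed
  have int_S: "integrable M (S n)" for n
    unfolding S_def using int' p_in
    by (intro integrable_mult_right Bochner_Integration.integrable_sum) auto
  have "0 \<le> (LINT x|M. \<bar>w' x a\<bar>)"
    by simp
  also have "\<dots> \<le> B"
    using bound[of a] \<open>a < b\<close> by simp
  finally have "B \<ge> 0" .
  have S_le: "(LINT x|M. \<bar>S n x\<bar>) \<le> (b - a) * B" for n
  proof -
    have "(LINT x|M. \<bar>S n x\<bar>) \<le> (LINT x|M. (b - a) / Suc n * (\<Sum>i<Suc n. \<bar>w' x (p n i)\<bar>))"
    proof (rule integral_mono)
      show "integrable M (\<lambda>x. (b - a) / Suc n * (\<Sum>i<Suc n. \<bar>w' x (p n i)\<bar>))"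
        using int' p_in by (intro integrable_mult_right Bochner_Integration.integrable_sum) auto
      show "\<bar>S n x\<bar> \<le> (b - a) / Suc n * (\<Sum>i<Suc n. \<bar>w' x (p n i)\<bar>)" for x
        using \<open>a < b\<close> unfolding S_def abs_mult
        by (simp add: divide_right_mono mult_left_mono sum_abs del: sum.lessThan_Suc of_nat_Suc)
    qed (use int_S in auto)
    also have "\<dots> = (b - a) / Suc n * (\<Sum>i<Suc n. LINT x|M. \<bar>w' x (p n i)\<bar>)"
      using int' p_in by (subst integral_mult_right_zero, subst Bochner_Integration.integral_sum) auto
    also have "\<dots> \<le> (b - a) / Suc n * (\<Sum>i<Suc n. B)"
      using \<open>a < b\<close> p_in by (intro mult_left_mono sum_mono bound) auto
    also have "\<dots> = (b - a) * B"
      by (simp del: sum.lessThan_Suc of_nat_Suc)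
    finally show ?thesis .
  qed
  have lim: "AE x in M. (\<lambda>n. S n x) \<longlonglongrightarrow> w x b - w x a"
    using der cont
  proof eventually_elim
    case (elim x)
    then show ?case
      unfolding S_def p_def
      by (intro left_Riemann_sums_tendsto) (use \<open>a < b\<close> in auto)
  qed
  have "(\<integral>\<^sup>+x. ennreal \<bar>w x b - w x a\<bar> \<partial>M) = (\<integral>\<^sup>+x. liminf (\<lambda>n. ennreal \<bar>S n x\<bar>) \<partial>M)"
  proof (rule nn_integral_cong_AE)
    show "AE x in M. ennreal \<bar>w x b - w x a\<bar> = liminf (\<lambda>n. ennreal \<bar>S n x\<bar>)"
      using lim
    proof eventually_elim
      case (elim x)
      then have "(\<lambda>n. ennreal \<bar>S n x\<bar>) \<longlonglongrightarrow> ennreal \<bar>w x b - w x a\<bar>"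
        by (intro tendsto_ennrealI tendsto_rabs)
      then show ?case
        by (intro lim_imp_Liminf[symmetric]) auto
    qed
  qed
  also have "\<dots> \<le> liminf (\<lambda>n. \<integral>\<^sup>+x. ennreal \<bar>S n x\<bar> \<partial>M)"
    using int_S by (intro nn_integral_liminf) auto
  also have "\<dots> \<le> liminf (\<lambda>n. ennreal ((b - a) * B))"
  proof (rule Liminf_mono, rule always_eventually, rule allI)
    fix n
    have "(\<integral>\<^sup>+x. ennreal \<bar>S n x\<bar> \<partial>M) = ennreal (LINT x|M. \<bar>S n x\<bar>)"
      using int_S by (intro nn_integral_eq_integral) auto
    also have "\<dots> \<le> ennreal ((b - a) * B)"
      using S_le by (intro ennreal_leI) auto
    finally show "(\<integral>\<^sup>+x. ennreal \<bar>S n x\<bar> \<partial>M) \<le> ennreal ((b - a) * B)" .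
  qed
  also have "\<dots> = ennreal ((b - a) * B)"
    by (simp add: Liminf_const)
  finally have "ennreal (LINT x|M. \<bar>w x b - w x a\<bar>) \<le> ennreal ((b - a) * B)"
    using int by (subst nn_integral_eq_integral[symmetric]) auto
  then show ?thesis
    using \<open>a < b\<close> \<open>B \<ge> 0\<close> by (simp add: ennreal_le_iff)
qed

section \<open>The weighted space on the half line\<close>

lemma identity_measurable_half_line: "(\<lambda>x. x) \<in> borel_measurable half_line"
  using id_borel_measurable_lebesgue_on[of "{0<..}"] by (simp add: id_def)

lemma borel_measurable_half_line: "f \<in> borel_measurable borel \<Longrightarrow> f \<in> borel_measurable half_line"
  by (rule measurable_compose[OF identity_measurable_half_line])

lemma integral_half_line:
  fixes f :: "real \<Rightarrow> real"
  shows "(LINT x|half_line. f x) = (LINT x|lebesgue. indicator {0<..} x * f x)"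
  by (subst integral_restrict_space) auto

lemma AE_half_line_iff: "(AE x in half_line. P x) \<longleftrightarrow> (AE x in lebesgue. x > 0 \<longrightarrow> P x)"
  by (subst AE_restrict_space_iff) auto

lemma sigma_finite_half_line: "sigma_finite_measure half_line"
proof (rule sigma_finite_measure_restrict_space)
  obtain A where "countable A" "A \<subseteq> sets lborel" "\<Union>A = (UNIV :: real set)"
      "\<forall>a\<in>A. emeasure lborel a \<noteq> \<infinity>"
    using lborel.sigma_finite_countable by auto
  then show "sigma_finite_measure (lebesgue :: real measure)"
    by (intro sigma_finite_measure.intro exI[of _ A]) auto
qed auto

lemma in_weighted_L1_measurable:
  assumes "in_weighted_L1 f"
  shows "f \<in> borel_measurable half_line"
proof -
  have [measurable]: "(\<lambda>x. f x * (1 + x)) \<in> borel_measurable half_line"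
    using assms unfolding in_weighted_L1_def by auto
  have [measurable]: "(\<lambda>x. 1 + x) \<in> borel_measurable half_line"
    by (rule borel_measurable_half_line) measurable
  have "(\<lambda>x. f x * (1 + x) / (1 + x)) \<in> borel_measurable half_line"
    by measurable
  then show ?thesis
    by (subst measurable_cong[where g = "\<lambda>x. f x * (1 + x) / (1 + x)"]) auto
qed

lemma in_weighted_L1_abs: "in_weighted_L1 f \<Longrightarrow> in_weighted_L1 (\<lambda>x. \<bar>f x\<bar>)"
  unfolding in_weighted_L1_def
  by (drule integrable_abs, erule Bochner_Integration.integrable_cong[THEN iffD1, rotated 2])
     (auto simp: abs_mult)

lemma in_weighted_L1_lincomb:
  assumes "in_weighted_L1 f" "in_weighted_L1 g"
  shows "in_weighted_L1 (\<lambda>x. a * f x + b * g x)"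
proof -
  have "integrable half_line (\<lambda>x. a * (f x * (1 + x)) + b * (g x * (1 + x)))"
    using assms unfolding in_weighted_L1_def by auto
  then show ?thesis
    unfolding in_weighted_L1_def by (simp add: algebra_simps)
qed

lemma in_weighted_L1_diff:
  "in_weighted_L1 f \<Longrightarrow> in_weighted_L1 g \<Longrightarrow> in_weighted_L1 (\<lambda>x. f x - g x)"
  using in_weighted_L1_lincomb[of f g 1 "-1"] by simp

lemma integrable_abs_weighted:
  "in_weighted_L1 f \<Longrightarrow> integrable half_line (\<lambda>x. \<bar>f x\<bar> * (1 + x))"
  using in_weighted_L1_abs unfolding in_weighted_L1_def .

lemma weighted_L1_norm_diff_le:
  assumes "in_weighted_L1 f" "in_weighted_L1 g"
  shows "weighted_L1_norm (\<lambda>x. f x - g x) \<le> weighted_L1_norm f + weighted_L1_norm g"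
proof -
  have "weighted_L1_norm (\<lambda>x. f x - g x)
      \<le> (LINT x|half_line. \<bar>f x\<bar> * (1 + x) + \<bar>g x\<bar> * (1 + x))"
    unfolding weighted_L1_norm_def
    using assms integrable_abs_weighted[OF in_weighted_L1_diff[OF assms]] integrable_abs_weighted
    by (intro integral_mono Bochner_Integration.integrable_add)
       (auto simp flip: distrib_right intro!: mult_right_mono abs_triangle_ineq4)
  also have "\<dots> = weighted_L1_norm f + weighted_L1_norm g"
    unfolding weighted_L1_norm_def
    using assms integrable_abs_weighted by (intro Bochner_Integration.integral_add) auto
  finally show ?thesis .
qed

text \<open>The dual of the weighted space consists of the functions of at most linear growth, such as the
  stationary solution and the Lyapunov functions below.\<close>

lemma
  assumes f: "in_weighted_L1 f" and \<psi> [measurable]: "\<psi> \<in> borel_measurable half_line"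
    and \<psi>_le: "AE x in half_line. \<bar>\<psi> x\<bar> \<le> C * (1 + x)"
  shows integrable_weighted_pairing: "integrable half_line (\<lambda>x. f x * \<psi> x)"
    and weighted_pairing_le: "\<bar>LINT x|half_line. f x * \<psi> x\<bar> \<le> C * weighted_L1_norm f"
proof -
  have [measurable]: "f \<in> borel_measurable half_line"
    using f by (rule in_weighted_L1_measurable)
  have bound: "AE x in half_line. \<bar>f x * \<psi> x\<bar> \<le> C * (\<bar>f x\<bar> * (1 + x))"
    using \<psi>_le
  proof eventually_elim
    case (elim x)
    then have "\<bar>f x\<bar> * \<bar>\<psi> x\<bar> \<le> \<bar>f x\<bar> * (C * (1 + x))"
      by (intro mult_left_mono) auto
    then show ?case
      by (simp add: abs_mult mult_ac)
  qed
  have int: "integrable half_line (\<lambda>x. C * (\<bar>f x\<bar> * (1 + x)))"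
    using integrable_abs_weighted[OF f] by simp
  show *: "integrable half_line (\<lambda>x. f x * \<psi> x)"
    by (rule Bochner_Integration.integrable_bound[OF int]) (use bound in auto)
  have "\<bar>LINT x|half_line. f x * \<psi> x\<bar> \<le> (LINT x|half_line. \<bar>f x * \<psi> x\<bar>)"
    by (rule integral_abs_bound)
  also have "\<dots> \<le> (LINT x|half_line. C * (\<bar>f x\<bar> * (1 + x)))"
    by (rule integral_mono_AE) (use * int bound in auto)
  also have "\<dots> = C * weighted_L1_norm f"
    by (simp add: weighted_L1_norm_def)
  finally show "\<bar>LINT x|half_line. f x * \<psi> x\<bar> \<le> C * weighted_L1_norm f" .
qed

section \<open>Convolution with an even kernel on the half line\<close>

text \<open>Restricting the integral to the half line builds in the exterior condition \<open>u = 0\<close> for \<open>x < 0\<close>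
  and makes the operator symmetric when the kernel is even.\<close>

definition half_conv :: "(real \<Rightarrow> real) \<Rightarrow> (real \<Rightarrow> real) \<Rightarrow> real \<Rightarrow> real" where
  "half_conv J f x = (LINT y|half_line. J (x - y) * f y)"

locale symmetric_kernel =
  fixes J :: "real \<Rightarrow> real" and d :: real
  assumes d_pos: "d > 0"
    and J_cont: "continuous_on UNIV J"
    and J_nonneg: "\<And>z. J z \<ge> 0"
    and J_even: "\<And>z. J (- z) = J z"
    and J_integral: "(LINT z|lborel. J z) = 1"
    and J_support: "\<And>z. \<bar>z\<bar> \<ge> d \<Longrightarrow> J z = 0"
begin

lemma J_measurable [measurable]: "J \<in> borel_measurable borel"
  using J_cont by (simp add: borel_measurable_continuous_onI)

lemma J_bounded: "\<exists>B>0. \<forall>z. J z \<le> B"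
proof -
  have "bounded (J ` {-d..d})"
    using J_cont by (intro compact_imp_bounded compact_continuous_image) (auto intro: continuous_on_subset)
  then obtain B where "B > 0" and B: "\<And>y. y \<in> J ` {-d..d} \<Longrightarrow> norm y \<le> B"
    unfolding bounded_pos by blast
  have "J z \<le> B" for z
  proof (cases "\<bar>z\<bar> \<ge> d")
    case True
    then show ?thesis
      using J_support \<open>B > 0\<close> by simp
  next
    case False
    then have "J z \<in> J ` {-d..d}"
      by (intro imageI) auto
    then show ?thesis
      using B by fastforce
  qed
  with \<open>B > 0\<close> show ?thesis
    by blast
qed

lemma integrable_J_times:
  assumes "continuous_on UNIV p"
  shows "integrable lborel (\<lambda>z. J z * p z)"
proof -
  have "set_integrable lborel {-d..d} (\<lambda>z. J z * p z)"
    by (intro borel_integrable_atLeastAtMost' continuous_intros)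
       (use assms J_cont in \<open>auto intro: continuous_on_subset\<close>)
  moreover have "(\<lambda>z. indicator {-d..d} z *\<^sub>R (J z * p z)) = (\<lambda>z. J z * p z)"
  proof
    fix z
    show "indicator {-d..d} z *\<^sub>R (J z * p z) = J z * p z"
      using J_support[of z] by (cases "\<bar>z\<bar> \<ge> d") (auto simp: indicator_def)
  qed
  ultimately show ?thesis
    by (simp only: set_integrable_def)
qed

lemma J_first_moment: "(LINT z|lborel. J z * z) = 0"
proof -
  have "(LINT z|lborel. J z * z) = (LINT z|lborel. J (-z) * (-z))"
    using lborel_integral_real_affine[of "-1" "\<lambda>z. J z * z" 0] by simp
  then show ?thesis
    by (simp add: J_even)
qed

definition second_moment :: real where
  "second_moment = (LINT z|lborel. J z * z\<^sup>2)"

lemma second_moment_pos: "second_moment > 0"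
proof -
  have int: "integrable lborel (\<lambda>z. J z * z\<^sup>2)"
    by (intro integrable_J_times continuous_intros)
  have "second_moment \<noteq> 0"
  proof
    assume "second_moment = 0"
    then have "AE z in lborel. J z * z\<^sup>2 = 0"
      using integral_nonneg_eq_0_iff_AE[OF int] J_nonneg by (simp add: second_moment_def)
    then have "AE z in lborel. J z = 0"
      using AE_lborel_singleton[of 0] by eventually_elim auto
    then have "(LINT z|lborel. J z) = 0"
      by (rule integral_eq_zero_AE)
    then show False
      using J_integral by simp
  qed
  moreover have "second_moment \<ge> 0"
    unfolding second_moment_def using J_nonneg by (intro integral_nonneg_AE) auto
  ultimately show ?thesis
    by simp
qed

text \<open>The source of all supersolutions used here.  Integrating the quadratic upper bound against the
  even kernel \<open>J\<close> removes the linear term and leaves the second moment.  Truncation of \<open>\<psi>\<close> to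
  the half line only helps: starting from \<open>x > 0\<close>, the kernel reaches no further than \<open>- d\<close>, and
  \<open>\<psi>\<close> is nonnegative there.\<close>

lemma half_conv_supersolution:
  assumes "x > 0"
    and nonneg: "\<And>y. y > - d \<Longrightarrow> \<psi> y \<ge> 0"
    and upper: "\<And>z. \<bar>z\<bar> < d \<Longrightarrow> \<psi> (x + z) \<le> \<psi> x + \<alpha> * z - \<kappa> * z\<^sup>2"
  shows "half_conv J \<psi> x \<le> \<psi> x - \<kappa> * second_moment"
proof -
  define q where "q z = \<psi> x + \<alpha> * z - \<kappa> * z\<^sup>2" for z
  have int: "integrable lborel (\<lambda>z. J z * q z)"
    unfolding q_def by (intro integrable_J_times continuous_intros)
  have int_shift: "integrable lborel (\<lambda>y. J (y - x) * q (y - x))"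
    using lborel_integrable_real_affine[OF int, of 1 "- x"] by (simp add: add.commute)
  have "half_conv J \<psi> x = (LINT y|lebesgue. indicator {0<..} y * (J (x - y) * \<psi> y))"
    unfolding half_conv_def by (rule integral_half_line)
  also have "\<dots> \<le> (LINT y|lebesgue. J (y - x) * q (y - x))"
  proof (rule integral_mono')
    show "integrable lebesgue (\<lambda>y. J (y - x) * q (y - x))"
      by (rule integrable_completion[THEN iffD2, OF _ int_shift]) (auto simp: q_def)
    have J_sym: "J (x - y) = J (y - x)" for y
      using J_even[of "y - x"] by simp
    have *: "0 \<le> J (y - x) * q (y - x) \<and> J (y - x) * \<psi> y \<le> J (y - x) * q (y - x)" for y
    proof (cases "\<bar>y - x\<bar> < d")
      case True
      then have "\<psi> y \<le> q (y - x)"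
        using upper[of "y - x"] by (simp add: q_def)
      moreover have "\<psi> y \<ge> 0"
        using True \<open>x > 0\<close> by (intro nonneg) auto
      ultimately show ?thesis
        using J_nonneg by (auto intro!: mult_left_mono)
    qed (simp add: J_support)
    then show "0 \<le> J (y - x) * q (y - x)" for y
      by blast
    show "indicator {0<..} y * (J (x - y) * \<psi> y) \<le> J (y - x) * q (y - x)" for y
      using *[of y] by (auto simp: indicator_def J_sym)
  qed
  also have "\<dots> = (LINT y|lborel. J (y - x) * q (y - x))"
    by (rule integral_completion) (auto simp: q_def)
  also have "\<dots> = (LINT z|lborel. J z * q z)"
    using lborel_integral_real_affine[of 1 "\<lambda>z. J z * q z" "- x"] by (simp add: add.commute)
  also have "\<dots> = (LINT z|lborel. \<psi> x * (J z * 1) + \<alpha> * (J z * z) - \<kappa> * (J z * z\<^sup>2))"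
    by (simp add: q_def algebra_simps)
  also have "\<dots> = \<psi> x * (LINT z|lborel. J z * 1) + \<alpha> * (LINT z|lborel. J z * z)
      - \<kappa> * (LINT z|lborel. J z * z\<^sup>2)"
  proof -
    have "integrable lborel (\<lambda>z. J z * 1)" "integrable lborel (\<lambda>z. J z * z)"
      "integrable lborel (\<lambda>z. J z * z\<^sup>2)"
      by (intro integrable_J_times continuous_intros)+
    then show ?thesis
      by (subst Bochner_Integration.integral_diff Bochner_Integration.integral_add; simp)+
  qed
  also have "\<dots> = \<psi> x - \<kappa> * second_moment"
    by (simp add: J_integral J_first_moment second_moment_def)
  finally show ?thesis .
qed

lemma half_conv_one_le: "x > 0 \<Longrightarrow> half_conv J (\<lambda>_. 1) x \<le> 1"
  using half_conv_supersolution[of x "\<lambda>_. 1" 0 0] by simp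

text \<open>The shift by at least \<open>d\<close> makes the affine function nonnegative on all points that the kernel
  reaches from the half line.\<close>

lemma half_conv_affine_le:
  "x > 0 \<Longrightarrow> c \<ge> d \<Longrightarrow> half_conv J (\<lambda>y. y + c) x \<le> x + c"
  using half_conv_supersolution[of x "\<lambda>y. y + c" 1 0] by simp

lemma J_shift_measurable [measurable]: "(\<lambda>y. J (x - y)) \<in> borel_measurable half_line"
  by (intro borel_measurable_half_line) measurable

lemma integrable_J_shift: "integrable half_line (\<lambda>y. J (x - y))"
proof -
  have "integrable lborel (\<lambda>z. J z * 1)"
    by (intro integrable_J_times continuous_intros)
  then have "integrable lborel (\<lambda>y. J (x - y))"
    using lborel_integrable_real_affine[of J "-1" x] by simp
  then have "integrable lebesgue (\<lambda>y. J (x - y))"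
    by (intro integrable_completion[THEN iffD2]) auto
  then show ?thesis
    using integrable_mult_indicator[of "{0<..}" lebesgue "\<lambda>y. J (x - y)"]
    by (subst integrable_restrict_space) auto
qed

text \<open>Fubini's theorem for the even kernel.  The double integral converges absolutely because the
  kernel only joins points at distance less than \<open>d\<close>, over which the weight \<open>1 + x\<close> changes by a
  factor of at most \<open>1 + d\<close>.\<close>

lemma half_conv_duality:
  assumes f: "in_weighted_L1 f"
    and \<psi> [measurable]: "\<psi> \<in> borel_measurable half_line"
    and "C \<ge> 0"
    and \<psi>_le: "AE x in half_line. \<bar>\<psi> x\<bar> \<le> C * (1 + x)"
  shows "integrable half_line (\<lambda>x. half_conv J f x * \<psi> x)"
    and "integrable half_line (\<lambda>x. f x * half_conv J \<psi> x)"
    and "(LINT x|half_line. half_conv J f x * \<psi> x) = (LINT x|half_line. f x * half_conv J \<psi> x)"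
proof -
  interpret H: sigma_finite_measure half_line
    by (rule sigma_finite_half_line)
  interpret P: pair_sigma_finite half_line half_line ..
  have f_meas [measurable]: "f \<in> borel_measurable half_line"
    using f by (rule in_weighted_L1_measurable)
  have [measurable]: "fst \<in> borel_measurable (half_line \<Otimes>\<^sub>M half_line)"
    "snd \<in> borel_measurable (half_line \<Otimes>\<^sub>M half_line)"
    using measurable_compose[OF measurable_fst identity_measurable_half_line]
      measurable_compose[OF measurable_snd identity_measurable_half_line] by auto
  have [measurable]: "(\<lambda>p. J (fst p - snd p)) \<in> borel_measurable (half_line \<Otimes>\<^sub>M half_line)"
    by measurable
  define G where "G y x = J (y - x) * f y * \<psi> x" for y x
  have G_meas [measurable]: "case_prod G \<in> borel_measurable (half_line \<Otimes>\<^sub>M half_line)"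
    unfolding G_def case_prod_beta by measurable
  have bound: "AE x in half_line. \<bar>G y x\<bar> \<le> C * (1 + d) * (\<bar>f y\<bar> * (1 + y)) * J (y - x)"
    if "y > 0" for y
    using \<psi>_le
  proof eventually_elim
    case (elim x)
    show ?case
    proof (cases "\<bar>y - x\<bar> < d")
      case True
      have "d * y \<ge> 0"
        using that d_pos by simp
      then have "1 + x \<le> (1 + d) * (1 + y)"
        using True by (simp add: algebra_simps)
      then have "C * (1 + x) \<le> C * ((1 + d) * (1 + y))"
        using \<open>C \<ge> 0\<close> by (rule mult_left_mono)
      with elim have "\<bar>\<psi> x\<bar> \<le> C * ((1 + d) * (1 + y))"
        by linarith
      then have "J (y - x) * \<bar>f y\<bar> * \<bar>\<psi> x\<bar> \<le> J (y - x) * \<bar>f y\<bar> * (C * ((1 + d) * (1 + y)))"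
        using J_nonneg by (intro mult_left_mono) auto
      then show ?thesis
        using J_nonneg[of "y - x"] by (simp add: G_def abs_mult mult_ac)
    qed (simp add: G_def J_support)
  qed
  have dom: "integrable half_line (\<lambda>x. C * (1 + d) * (\<bar>f y\<bar> * (1 + y)) * J (y - x))" for y
    using integrable_J_shift by simp
  have G_meas' [measurable]: "G y \<in> borel_measurable half_line" for y
    unfolding G_def by measurable
  have int_x: "integrable half_line (G y)" if "y > 0" for y
    by (rule Bochner_Integration.integrable_bound[OF dom[of y]])
       (use bound[OF that] in \<open>auto elim!: eventually_mono\<close>)
  have int_G: "integrable (half_line \<Otimes>\<^sub>M half_line) (case_prod G)"
  proof (rule P.Fubini_integrable)
    show "integrable half_line (\<lambda>y. LINT x|half_line. norm (case (y, x) of (y, x) \<Rightarrow> G y x))"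
    proof (rule Bochner_Integration.integrable_bound)
      show "integrable half_line (\<lambda>y. C * (1 + d) * (\<bar>f y\<bar> * (1 + y)))"
        using integrable_abs_weighted[OF f] by simp
      show "(\<lambda>y. LINT x|half_line. norm (case (y, x) of (y, x) \<Rightarrow> G y x)) \<in> borel_measurable half_line"
        by measurable
      show "AE y in half_line. norm (LINT x|half_line. norm (case (y, x) of (y, x) \<Rightarrow> G y x))
          \<le> norm (C * (1 + d) * (\<bar>f y\<bar> * (1 + y)))"
      proof (rule AE_I2)
        fix y :: real
        assume "y \<in> space half_line"
        then have "y > 0"
          by simp
        have nn: "C * (1 + d) * (\<bar>f y\<bar> * (1 + y)) \<ge> 0"
          using \<open>C \<ge> 0\<close> d_pos \<open>y > 0\<close> by simp
        have "(LINT x|half_line. \<bar>G y x\<bar>)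
            \<le> (LINT x|half_line. C * (1 + d) * (\<bar>f y\<bar> * (1 + y)) * J (y - x))"
          using int_x[OF \<open>y > 0\<close>] dom bound[OF \<open>y > 0\<close>] by (intro integral_mono_AE) auto
        also have "\<dots> = C * (1 + d) * (\<bar>f y\<bar> * (1 + y)) * half_conv J (\<lambda>_. 1) y"
          by (simp add: half_conv_def)
        also have "\<dots> \<le> C * (1 + d) * (\<bar>f y\<bar> * (1 + y)) * 1"
          using half_conv_one_le[OF \<open>y > 0\<close>] nn by (intro mult_left_mono) auto
        finally show "norm (LINT x|half_line. norm (case (y, x) of (y, x) \<Rightarrow> G y x))
            \<le> norm (C * (1 + d) * (\<bar>f y\<bar> * (1 + y)))"
          using nn by simp
      qed
    qed
    show "AE y in half_line. integrable half_line (\<lambda>x. case (y, x) of (y, x) \<Rightarrow> G y x)"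
      using int_x by (intro AE_I2) auto
  qed measurable
  have inner_y: "(LINT x|half_line. G y x) = f y * half_conv J \<psi> y" for y
    unfolding G_def half_conv_def by (subst integral_mult_right_zero[symmetric]) (simp add: mult_ac)
  have inner_x: "(LINT y|half_line. G y x) = half_conv J f x * \<psi> x" for x
  proof -
    have "J (y - x) = J (x - y)" for y
      using J_even[of "x - y"] by simp
    then show ?thesis
      unfolding G_def half_conv_def by simp
  qed
  show "integrable half_line (\<lambda>x. half_conv J f x * \<psi> x)"
    using P.integrable_snd[OF int_G] by (simp add: inner_x)
  show "integrable half_line (\<lambda>x. f x * half_conv J \<psi> x)"
    using P.integrable_fst[OF int_G] by (simp add: inner_y)
  show "(LINT x|half_line. half_conv J f x * \<psi> x) = (LINT x|half_line. f x * half_conv J \<psi> x)"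
    using P.Fubini_integral[OF int_G] by (simp add: inner_x inner_y)
qed

end

context symmetric_kernel
begin

lemma half_conv_measurable:
  assumes "in_weighted_L1 f"
  shows "half_conv J f \<in> borel_measurable half_line"
proof -
  have "integrable half_line (\<lambda>x. half_conv J f x * 1)"
    using assms by (rule half_conv_duality(1)[where C = 1]) (auto intro!: AE_I2)
  then show ?thesis
    by auto
qed

lemma integrable_J_shift_times:
  assumes f: "in_weighted_L1 f"
  shows "integrable half_line (\<lambda>y. J (x - y) * f y)"
proof -
  obtain B where "B > 0" and B: "\<And>z. J z \<le> B"
    using J_bounded by blast
  have "integrable half_line (\<lambda>y. f y * J (x - y))"
  proof (rule integrable_weighted_pairing[OF f, where C = B])
    show "AE y in half_line. \<bar>J (x - y)\<bar> \<le> B * (1 + y)"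
    proof (rule AE_I2)
      fix y :: real
      assume "y \<in> space half_line"
      then have "B * 1 \<le> B * (1 + y)"
        using \<open>B > 0\<close> by (intro mult_left_mono) auto
      then show "\<bar>J (x - y)\<bar> \<le> B * (1 + y)"
        using B[of "x - y"] J_nonneg[of "x - y"] by simp
    qed
  qed measurable
  then show ?thesis
    by (simp add: mult.commute)
qed

lemma half_conv_diff:
  assumes "in_weighted_L1 f" "in_weighted_L1 g"
  shows "half_conv J (\<lambda>x. f x - g x) x = half_conv J f x - half_conv J g x"
  using integrable_J_shift_times[OF assms(1)] integrable_J_shift_times[OF assms(2)]
  unfolding half_conv_def by (simp add: right_diff_distrib)

lemma abs_half_conv_le:
  "\<bar>half_conv J f x\<bar> \<le> half_conv J (\<lambda>y. \<bar>f y\<bar>) x"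
proof -
  have "\<bar>half_conv J f x\<bar> \<le> (LINT y|half_line. \<bar>J (x - y) * f y\<bar>)"
    unfolding half_conv_def by (rule integral_abs_bound)
  then show ?thesis
    using J_nonneg by (simp add: half_conv_def abs_mult)
qed

text \<open>Makes the evaluation of the convolution at a fixed point continuous in the weighted norm, which
  yields the continuity in time of the right-hand side of the equation.\<close>

lemma half_conv_pointwise_bound: "\<exists>B>0. \<forall>f x. in_weighted_L1 f \<longrightarrow> \<bar>half_conv J f x\<bar> \<le> B * weighted_L1_norm f"
proof -
  obtain B where "B > 0" and B: "\<And>z. J z \<le> B"
    using J_bounded by blast
  have "\<bar>half_conv J f x\<bar> \<le> B * weighted_L1_norm f" if f: "in_weighted_L1 f" for f x
  proof -
    have "\<bar>half_conv J f x\<bar> \<le> (LINT y|half_line. J (x - y) * \<bar>f y\<bar>)"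
      using abs_half_conv_le[of f x] by (simp add: half_conv_def)
    also have "\<dots> \<le> (LINT y|half_line. B * (\<bar>f y\<bar> * (1 + y)))"
    proof (rule integral_mono)
      show "integrable half_line (\<lambda>y. J (x - y) * \<bar>f y\<bar>)"
        using integrable_J_shift_times[OF in_weighted_L1_abs[OF f]] .
      show "integrable half_line (\<lambda>y. B * (\<bar>f y\<bar> * (1 + y)))"
        using integrable_abs_weighted[OF f] by simp
      show "J (x - y) * \<bar>f y\<bar> \<le> B * (\<bar>f y\<bar> * (1 + y))" if "y \<in> space half_line" for y
        using that B J_nonneg \<open>B > 0\<close> by (intro mult_mono) (auto simp: mult_le_cancel_left1)
    qed
    also have "\<dots> = B * weighted_L1_norm f"
      by (simp add: weighted_L1_norm_def)
    finally show ?thesis .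
  qed
  with \<open>B > 0\<close> show ?thesis
    by blast
qed

text \<open>Duality with the supersolution \<open>x + (1 + d)\<close>, which lies between \<open>1 + x\<close> and
  \<open>(1 + d) * (1 + x)\<close>.\<close>

lemma
  assumes f: "in_weighted_L1 f"
  shows in_weighted_L1_half_conv: "in_weighted_L1 (half_conv J f)"
    and weighted_L1_norm_half_conv_le: "weighted_L1_norm (half_conv J f) \<le> (1 + d) * weighted_L1_norm f"
proof -
  note af = in_weighted_L1_abs[OF f]
  define \<psi> where "\<psi> = (\<lambda>x. x + (1 + d))"
  have affine_le: "AE x in half_line. \<bar>\<psi> x\<bar> \<le> (1 + d) * (1 + x)"
    using d_pos by (intro AE_I2) (simp add: \<psi>_def algebra_simps)
  have \<psi>_meas: "\<psi> \<in> borel_measurable half_line"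
    unfolding \<psi>_def by (rule borel_measurable_half_line) measurable
  have "1 + d \<ge> 0"
    using d_pos by simp
  note duality = half_conv_duality[OF af \<psi>_meas \<open>1 + d \<ge> 0\<close> affine_le]
  have pointwise: "\<bar>half_conv J f x\<bar> * (1 + x) \<le> half_conv J (\<lambda>y. \<bar>f y\<bar>) x * \<psi> x"
    if "x \<in> space half_line" for x
    using that d_pos abs_half_conv_le[of f x]
    by (intro mult_mono) (auto simp: \<psi>_def)
  show *: "in_weighted_L1 (half_conv J f)"
    unfolding in_weighted_L1_def
  proof (rule Bochner_Integration.integrable_bound[OF duality(1)])
    have [measurable]: "half_conv J f \<in> borel_measurable half_line" "(\<lambda>x. 1 + x) \<in> borel_measurable half_line"
      using half_conv_measurable[OF f] by (auto intro: borel_measurable_half_line)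
    show "(\<lambda>x. half_conv J f x * (1 + x)) \<in> borel_measurable half_line"
      by measurable
    show "AE x in half_line. norm (half_conv J f x * (1 + x))
        \<le> norm (half_conv J (\<lambda>y. \<bar>f y\<bar>) x * \<psi> x)"
    proof (rule AE_I2)
      fix x
      assume x: "x \<in> space half_line"
      then show "norm (half_conv J f x * (1 + x)) \<le> norm (half_conv J (\<lambda>y. \<bar>f y\<bar>) x * \<psi> x)"
        using order_trans[OF pointwise[OF x] abs_ge_self] by (simp add: abs_mult)
    qed
  qed
  have "weighted_L1_norm (half_conv J f) \<le> (LINT x|half_line. half_conv J (\<lambda>y. \<bar>f y\<bar>) x * \<psi> x)"
    unfolding weighted_L1_norm_def
    by (rule integral_mono[OF integrable_abs_weighted[OF *] duality(1) pointwise])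
  also have "\<dots> = (LINT x|half_line. \<bar>f x\<bar> * half_conv J \<psi> x)"
    by (rule duality(3))
  also have "\<dots> \<le> (LINT x|half_line. (1 + d) * (\<bar>f x\<bar> * (1 + x)))"
  proof (rule integral_mono[OF duality(2)])
    show "integrable half_line (\<lambda>x. (1 + d) * (\<bar>f x\<bar> * (1 + x)))"
      using integrable_abs_weighted[OF f] by simp
    fix x :: real
    assume "x \<in> space half_line"
    then have "half_conv J \<psi> x \<le> \<psi> x" "d * x \<ge> 0"
      using half_conv_affine_le[of x "1 + d"] d_pos by (auto simp: \<psi>_def)
    then have "half_conv J \<psi> x \<le> (1 + d) * (1 + x)"
      by (simp add: \<psi>_def algebra_simps)
    then have "\<bar>f x\<bar> * half_conv J \<psi> x \<le> \<bar>f x\<bar> * ((1 + d) * (1 + x))"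
      by (rule mult_left_mono) simp
    then show "\<bar>f x\<bar> * half_conv J \<psi> x \<le> (1 + d) * (\<bar>f x\<bar> * (1 + x))"
      by (simp add: mult_ac)
  qed
  also have "\<dots> = (1 + d) * weighted_L1_norm f"
    by (simp add: weighted_L1_norm_def)
  finally show "weighted_L1_norm (half_conv J f) \<le> (1 + d) * weighted_L1_norm f" .
qed

definition generator :: "(real \<Rightarrow> real) \<Rightarrow> real \<Rightarrow> real" where
  "generator f x = half_conv J f x - f x"

lemma generator_diff:
  "in_weighted_L1 f \<Longrightarrow> in_weighted_L1 g \<Longrightarrow>
    generator (\<lambda>x. f x - g x) x = generator f x - generator g x"
  by (simp add: generator_def half_conv_diff)

lemma
  assumes f: "in_weighted_L1 f"
  shows in_weighted_L1_generator: "in_weighted_L1 (generator f)"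
    and weighted_L1_norm_generator_le: "weighted_L1_norm (generator f) \<le> (2 + d) * weighted_L1_norm f"
proof -
  have gen: "generator f = (\<lambda>x. half_conv J f x - f x)"
    by (simp add: generator_def fun_eq_iff)
  show "in_weighted_L1 (generator f)"
    unfolding gen using f by (intro in_weighted_L1_diff in_weighted_L1_half_conv)
  show "weighted_L1_norm (generator f) \<le> (2 + d) * weighted_L1_norm f"
    using weighted_L1_norm_diff_le[OF in_weighted_L1_half_conv[OF f] f] weighted_L1_norm_half_conv_le[OF f]
    unfolding gen by (simp add: algebra_simps)
qed

end

section \<open>The evolution equation in the weighted norm\<close>

locale half_line_evolution = symmetric_kernel +
  fixes u :: "real \<Rightarrow> real \<Rightarrow> real"
  assumes u_cont: "continuous_weighted_L1 u"
    and u_equation: "AE x in half_line. \<forall>t>0.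
      (u x has_real_derivative (half_conv J (\<lambda>y. u y t) x - u x t)) (at t)"
begin

lemma u_in: "t \<ge> 0 \<Longrightarrow> in_weighted_L1 (\<lambda>x. u x t)"
  using u_cont by (simp add: continuous_weighted_L1_def)

lemma u_measurable: "t \<ge> 0 \<Longrightarrow> (\<lambda>x. u x t) \<in> borel_measurable half_line"
  using u_in in_weighted_L1_measurable by blast

lemma u_norm_continuous:
  assumes "s \<ge> 0" "e > 0"
  shows "\<exists>\<delta>>0. \<forall>t\<ge>0. \<bar>t - s\<bar> < \<delta> \<longrightarrow> weighted_L1_norm (\<lambda>x. u x t - u x s) < e"
proof -
  have "((\<lambda>t. weighted_L1_norm (\<lambda>x. u x t - u x s)) \<longlongrightarrow> 0) (at s within {0..})"
    using u_cont \<open>s \<ge> 0\<close> by (simp add: continuous_weighted_L1_def)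
  then have "eventually (\<lambda>t. weighted_L1_norm (\<lambda>x. u x t - u x s) < e) (at s within {0..})"
    using \<open>e > 0\<close> by (rule order_tendstoD)
  then obtain \<delta> where "\<delta> > 0"
    and \<delta>: "\<And>t. t \<in> {0..} \<Longrightarrow> t \<noteq> s \<Longrightarrow> dist t s < \<delta> \<Longrightarrow> weighted_L1_norm (\<lambda>x. u x t - u x s) < e"
    unfolding eventually_at by blast
  have "weighted_L1_norm (\<lambda>x. u x s - u x s) < e"
    using \<open>e > 0\<close> by (simp add: weighted_L1_norm_def)
  then have "weighted_L1_norm (\<lambda>x. u x t - u x s) < e" if "t \<ge> 0" "\<bar>t - s\<bar> < \<delta>" for t
    using \<delta>[of t] that by (cases "t = s") (auto simp: dist_real_def)
  with \<open>\<delta> > 0\<close> show ?thesis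
    by blast
qed

lemma half_conv_u_continuous:
  "continuous_on {0..} (\<lambda>t. half_conv J (\<lambda>y. u y t) x)"
proof -
  obtain B where "B > 0"
    and B: "\<And>f. in_weighted_L1 f \<Longrightarrow> \<bar>half_conv J f x\<bar> \<le> B * weighted_L1_norm f"
    using half_conv_pointwise_bound by blast
  show ?thesis
    unfolding continuous_on_iff
  proof (intro ballI allI impI)
    fix s e :: real
    assume "s \<in> {0..}" "e > 0"
    then obtain \<delta> where "\<delta> > 0"
      and \<delta>: "\<And>t. t \<ge> 0 \<Longrightarrow> \<bar>t - s\<bar> < \<delta> \<Longrightarrow> weighted_L1_norm (\<lambda>x. u x t - u x s) < e / B"
      using u_norm_continuous[of s "e / B"] \<open>B > 0\<close> by auto
    have "\<bar>half_conv J (\<lambda>y. u y t) x - half_conv J (\<lambda>y. u y s) x\<bar> < e"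
      if "t \<ge> 0" "\<bar>t - s\<bar> < \<delta>" for t
    proof -
      have t: "in_weighted_L1 (\<lambda>y. u y t)" and s: "in_weighted_L1 (\<lambda>y. u y s)"
        using that \<open>s \<in> {0..}\<close> by (auto intro: u_in)
      have "\<bar>half_conv J (\<lambda>y. u y t) x - half_conv J (\<lambda>y. u y s) x\<bar>
          \<le> B * weighted_L1_norm (\<lambda>x. u x t - u x s)"
        using B[OF in_weighted_L1_diff[OF t s]] half_conv_diff[OF t s] by simp
      also have "\<dots> < B * (e / B)"
        using \<delta> that \<open>B > 0\<close> by (intro mult_strict_left_mono) auto
      finally show ?thesis
        using \<open>B > 0\<close> by simp
    qed
    with \<open>\<delta> > 0\<close> show "\<exists>\<delta>>0. \<forall>t\<in>{0..}. dist t s < \<delta> \<longrightarrow>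
        dist (half_conv J (\<lambda>y. u y t) x) (half_conv J (\<lambda>y. u y s) x) < e"
      by (auto simp: dist_real_def)
  qed
qed

text \<open>The mean value inequality for the curve \<open>r \<mapsto> u r - r * generator (u a)\<close>, multiplied by the weight;
  its derivative, the generator applied to \<open>u r - u a\<close>, is small because the generator is bounded on
  the weighted space.\<close>

lemma euler_step_le:
  assumes "0 < a" "a < b"
    and close: "\<And>r. r \<in> {a..b} \<Longrightarrow> weighted_L1_norm (\<lambda>x. u x r - u x a) \<le> e"
  shows "weighted_L1_norm (\<lambda>x. u x b - u x a - (b - a) * generator (\<lambda>y. u y a) x)
    \<le> (b - a) * ((2 + d) * e)"
proof -
  define A where "A r = generator (\<lambda>y. u y r)" for r
  define w where "w x r = (u x r - r * A a x) * (1 + x)" for x r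
  define w' where "w' x r = (A r x - A a x) * (1 + x)" for x r
  have A_in: "in_weighted_L1 (A r)" if "r \<ge> 0" for r
    unfolding A_def using that by (intro in_weighted_L1_generator u_in)
  have "(LINT x|half_line. \<bar>w x b - w x a\<bar>) \<le> (b - a) * ((2 + d) * e)"
  proof (rule L1_mean_value_inequality[OF \<open>a < b\<close>])
    show "AE x in half_line. \<forall>r\<in>{a..b}. (w x has_real_derivative w' x r) (at r)"
      using u_equation
    proof eventually_elim
      case (elim x)
      show ?case
      proof
        fix r
        assume "r \<in> {a..b}"
        then have "(u x has_real_derivative A r x) (at r)"
          using elim \<open>0 < a\<close> by (simp add: A_def generator_def)
        then show "(w x has_real_derivative w' x r) (at r)"
          unfolding w_def w'_def by (auto intro!: derivative_eq_intros simp: algebra_simps)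
      qed
    qed
    show "AE x in half_line. continuous_on {a..b} (w' x)"
      using u_equation
    proof eventually_elim
      case (elim x)
      have "continuous_on {a..b} (u x)"
        using elim \<open>0 < a\<close>
        by (intro continuous_at_imp_continuous_on ballI DERIV_isCont[OF elim[rule_format]]) auto
      moreover have "continuous_on {a..b} (\<lambda>r. half_conv J (\<lambda>y. u y r) x)"
        using \<open>0 < a\<close> by (intro continuous_on_subset[OF half_conv_u_continuous]) auto
      ultimately show ?case
        unfolding w'_def A_def generator_def by (intro continuous_intros)
    qed
    show "integrable half_line (\<lambda>x. w x b - w x a)"
    proof -
      have "in_weighted_L1 (\<lambda>x. (u x b - u x a) - (1 * ((b - a) * A a x) + 0 * u x a))"
        using \<open>0 < a\<close> \<open>a < b\<close> in_weighted_L1_lincomb[OF A_in[of a] A_in[of a], of "b - a" 0]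
        by (intro in_weighted_L1_diff in_weighted_L1_lincomb u_in) auto
      then show ?thesis
        by (simp add: in_weighted_L1_def w_def algebra_simps)
    qed
    fix r
    assume r: "r \<in> {a..b}"
    show "integrable half_line (\<lambda>x. w' x r)"
      using in_weighted_L1_diff[OF A_in[of r] A_in[of a]] r \<open>0 < a\<close>
      by (simp add: in_weighted_L1_def w'_def)
    have u_r: "in_weighted_L1 (\<lambda>y. u y r)" and u_a: "in_weighted_L1 (\<lambda>y. u y a)"
      using r \<open>0 < a\<close> by (auto intro: u_in)
    have "(LINT x|half_line. \<bar>w' x r\<bar>) = weighted_L1_norm (generator (\<lambda>y. u y r - u y a))"
      unfolding weighted_L1_norm_def
      using generator_diff[OF u_r u_a]
      by (intro Bochner_Integration.integral_cong) (auto simp: w'_def A_def abs_mult)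
    also have "\<dots> \<le> (2 + d) * weighted_L1_norm (\<lambda>y. u y r - u y a)"
      using u_r u_a by (intro weighted_L1_norm_generator_le in_weighted_L1_diff)
    also have "\<dots> \<le> (2 + d) * e"
      using close[OF r] d_pos by (intro mult_left_mono) auto
    finally show "(LINT x|half_line. \<bar>w' x r\<bar>) \<le> (2 + d) * e" .
  qed
  also have "(LINT x|half_line. \<bar>w x b - w x a\<bar>)
      = weighted_L1_norm (\<lambda>x. u x b - u x a - (b - a) * generator (\<lambda>y. u y a) x)"
    unfolding weighted_L1_norm_def
  proof (intro Bochner_Integration.integral_cong refl)
    fix x :: real
    assume "x \<in> space half_line"
    moreover have "w x b - w x a = (u x b - u x a - (b - a) * generator (\<lambda>y. u y a) x) * (1 + x)"
      by (simp add: w_def A_def algebra_simps)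
    ultimately show "\<bar>w x b - w x a\<bar>
        = \<bar>u x b - u x a - (b - a) * generator (\<lambda>y. u y a) x\<bar> * (1 + x)"
      by (simp add: abs_mult)
  qed
  finally show ?thesis .
qed

text \<open>The equation, given pointwise in \<open>x\<close>, thus holds in the norm of the weighted space.  The two-sided
  form, with \<open>c\<close> anywhere between \<open>a\<close> and \<open>b\<close>, is the one that a compactness argument in time can
  use.\<close>

lemma euler_step:
  assumes "c > 0" "e > 0"
  shows "\<exists>\<delta>>0. \<forall>a b. 0 < a \<longrightarrow> a \<le> c \<longrightarrow> c \<le> b \<longrightarrow> b - a < \<delta> \<longrightarrow>
    weighted_L1_norm (\<lambda>x. u x b - u x a - (b - a) * generator (\<lambda>y. u y a) x) \<le> e * (b - a)"
proof -
  \<comment> \<open>The factor \<open>2 + d\<close> bounds the generator; the factor 2 comes from comparing \<open>r\<close> and \<open>a\<close> through \<open>c\<close>.\<close>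
  define \<eta> where "\<eta> = e / (2 * (2 + d))"
  have "\<eta> > 0"
    using \<open>e > 0\<close> d_pos by (simp add: \<eta>_def)
  then obtain \<delta> where "\<delta> > 0"
    and \<delta>: "\<And>t. t \<ge> 0 \<Longrightarrow> \<bar>t - c\<bar> < \<delta> \<Longrightarrow> weighted_L1_norm (\<lambda>x. u x t - u x c) < \<eta>"
    using u_norm_continuous[of c \<eta>] \<open>c > 0\<close> by auto
  have "weighted_L1_norm (\<lambda>x. u x b - u x a - (b - a) * generator (\<lambda>y. u y a) x) \<le> e * (b - a)"
    if ab: "0 < a" "a \<le> c" "c \<le> b" "b - a < \<delta>" for a b
  proof (cases "a = b")
    case True
    then show ?thesis
      by (simp add: weighted_L1_norm_def)
  next
    case False
    have "weighted_L1_norm (\<lambda>x. u x b - u x a - (b - a) * generator (\<lambda>y. u y a) x)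
        \<le> (b - a) * ((2 + d) * (2 * \<eta>))"
    proof (rule euler_step_le)
      fix r
      assume r: "r \<in> {a..b}"
      have "weighted_L1_norm (\<lambda>x. (u x r - u x c) - (u x a - u x c))
          \<le> weighted_L1_norm (\<lambda>x. u x r - u x c) + weighted_L1_norm (\<lambda>x. u x a - u x c)"
        using r ab \<open>c > 0\<close> by (intro weighted_L1_norm_diff_le in_weighted_L1_diff u_in) auto
      then show "weighted_L1_norm (\<lambda>x. u x r - u x a) \<le> 2 * \<eta>"
        using \<delta>[of r] \<delta>[of a] r ab by (simp add: abs_less_iff)
    qed (use ab False in auto)
    also have "(2 + d) * (2 * \<eta>) = e"
      using d_pos by (simp add: \<eta>_def field_simps)
    finally show ?thesis
      by (simp add: mult.commute)
  qed
  with \<open>\<delta> > 0\<close> show ?thesis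
    by blast
qed

end

section \<open>Lyapunov functions and conserved quantities\<close>

text \<open>Compactness of the interval turns the local estimates into a global one.  This serves functionals
  such as the absolute integral, which have one-sided bounds for their increments but no derivative.\<close>

lemma increment_bound_from_local:
  fixes F :: "real \<Rightarrow> real"
  assumes "s \<le> T"
    and local: "\<And>c e. s \<le> c \<Longrightarrow> c \<le> T \<Longrightarrow> e > 0 \<Longrightarrow> \<exists>\<delta>>0. \<forall>a b. s \<le> a \<longrightarrow> a \<le> c \<longrightarrow> c \<le> b \<longrightarrow> b \<le> T \<longrightarrow>
      b - a < \<delta> \<longrightarrow> F b - F a \<le> (L + e) * (b - a)"
  shows "F T - F s \<le> L * (T - s)"
proof -
  have eps: "F T - F s \<le> (L + e) * (T - s)" if "e > 0" for e
  proof -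
    define P where "P a b \<longleftrightarrow> (s \<le> a \<longrightarrow> a \<le> b \<longrightarrow> b \<le> T \<longrightarrow> F b - F a \<le> (L + e) * (b - a))" for a b
    have "P s T"
      using \<open>s \<le> T\<close>
    proof (rule Bolzano)
      fix a b c
      assume *: "P a b" "P b c" "a \<le> b" "b \<le> c"
      show "P a c"
        unfolding P_def
      proof (intro impI)
        assume "s \<le> a" "a \<le> c" "c \<le> T"
        then have "F b - F a \<le> (L + e) * (b - a)" "F c - F b \<le> (L + e) * (c - b)"
          using * unfolding P_def by auto
        then show "F c - F a \<le> (L + e) * (c - a)"
          by (simp add: algebra_simps)
      qed
    next
      fix x
      assume "s \<le> x" "x \<le> T"
      then obtain \<delta> where "\<delta> > 0" "\<forall>a b. s \<le> a \<longrightarrow> a \<le> x \<longrightarrow> x \<le> b \<longrightarrow> b \<le> T \<longrightarrow>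
          b - a < \<delta> \<longrightarrow> F b - F a \<le> (L + e) * (b - a)"
        using local[OF _ _ \<open>e > 0\<close>] by blast
      then show "\<exists>d>0. \<forall>a b. a \<le> x \<and> x \<le> b \<and> b - a < d \<longrightarrow> P a b"
        unfolding P_def by blast
    qed
    then show ?thesis
      using \<open>s \<le> T\<close> by (simp add: P_def)
  qed
  show ?thesis
  proof (rule field_le_epsilon)
    fix e :: real
    assume "e > 0"
    define \<eta> where "\<eta> = e / (T - s + 1)"
    have "\<eta> > 0" "\<eta> * (T - s) \<le> e"
      using \<open>e > 0\<close> \<open>s \<le> T\<close> by (simp_all add: \<eta>_def field_simps)
    then show "F T - F s \<le> L * (T - s) + e"
      using eps[of \<eta>] by (simp add: algebra_simps)
  qed
qed

context symmetric_kernel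
begin

text \<open>For \<open>h \<le> 1\<close> the explicit Euler step \<open>(1 - h) * f + h * half_conv J f\<close> has nonnegative weights, so
  absolute values can be taken inside.  In this way the linear equation controls \<open>\<bar>u\<bar>\<close>, for which
  there is no equation.\<close>

lemma euler_step_supersolution:
  assumes f: "in_weighted_L1 f" and g: "in_weighted_L1 g"
    and "0 \<le> h" "h \<le> 1"
    and \<psi>: "\<psi> \<in> borel_measurable half_line"
    and \<psi>_nonneg: "\<And>x. x > 0 \<Longrightarrow> \<psi> x \<ge> 0"
    and "C \<ge> 0" and \<psi>_le: "\<And>x. x > 0 \<Longrightarrow> \<psi> x \<le> C * (1 + x)"
  shows "(LINT x|half_line. \<bar>g x\<bar> * \<psi> x) \<le> (LINT x|half_line. \<bar>f x\<bar> * \<psi> x)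
    - h * (LINT x|half_line. \<bar>f x\<bar> * (\<psi> x - half_conv J \<psi> x))
    + C * weighted_L1_norm (\<lambda>x. g x - f x - h * generator f x)"
proof -
  define R where "R x = g x - f x - h * generator f x" for x
  define K where "K = half_conv J (\<lambda>y. \<bar>f y\<bar>)"
  have R: "in_weighted_L1 R"
    unfolding R_def using in_weighted_L1_lincomb[OF in_weighted_L1_generator[OF f] f, of h 0] f g
    by (intro in_weighted_L1_diff) auto
  have \<psi>_AE: "AE x in half_line. \<bar>\<psi> x\<bar> \<le> C * (1 + x)"
    using \<psi>_nonneg \<psi>_le by (intro AE_I2) auto
  note dual = half_conv_duality[OF in_weighted_L1_abs[OF f] \<psi> \<open>C \<ge> 0\<close> \<psi>_AE]
  have pair: "integrable half_line (\<lambda>x. \<bar>F x\<bar> * \<psi> x)" if "in_weighted_L1 F" for F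
    using integrable_weighted_pairing[OF in_weighted_L1_abs[OF that] \<psi> \<psi>_AE] .
  have "(LINT x|half_line. \<bar>g x\<bar> * \<psi> x)
      \<le> (LINT x|half_line. (1 - h) * (\<bar>f x\<bar> * \<psi> x) + h * (K x * \<psi> x) + \<bar>R x\<bar> * \<psi> x)"
  proof (rule integral_mono)
    show "integrable half_line (\<lambda>x. (1 - h) * (\<bar>f x\<bar> * \<psi> x) + h * (K x * \<psi> x) + \<bar>R x\<bar> * \<psi> x)"
      using pair[OF f] pair[OF R] dual(1) by (auto simp: K_def)
    fix x :: real
    assume "x \<in> space half_line"
    then have "\<psi> x \<ge> 0"
      using \<psi>_nonneg by simp
    have "g x = (1 - h) * f x + h * half_conv J f x + R x"
      by (simp add: R_def generator_def algebra_simps)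
    then have "\<bar>g x\<bar> \<le> \<bar>(1 - h) * f x\<bar> + \<bar>h * half_conv J f x\<bar> + \<bar>R x\<bar>"
      by linarith
    also have "\<bar>(1 - h) * f x\<bar> = (1 - h) * \<bar>f x\<bar>"
      using \<open>h \<le> 1\<close> by (simp add: abs_mult)
    also have "\<bar>h * half_conv J f x\<bar> \<le> h * K x"
      using abs_half_conv_le[of f x] \<open>0 \<le> h\<close> by (simp add: abs_mult K_def mult_left_mono)
    finally have "\<bar>g x\<bar> * \<psi> x \<le> ((1 - h) * \<bar>f x\<bar> + h * K x + \<bar>R x\<bar>) * \<psi> x"
      using \<open>\<psi> x \<ge> 0\<close> by (simp add: mult_right_mono)
    then show "\<bar>g x\<bar> * \<psi> x \<le> (1 - h) * (\<bar>f x\<bar> * \<psi> x) + h * (K x * \<psi> x) + \<bar>R x\<bar> * \<psi> x"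
      by (simp add: algebra_simps)
  qed (rule pair[OF g])
  also have "\<dots> = (1 - h) * (LINT x|half_line. \<bar>f x\<bar> * \<psi> x) + h * (LINT x|half_line. K x * \<psi> x)
      + (LINT x|half_line. \<bar>R x\<bar> * \<psi> x)"
    using pair[OF f] pair[OF R] dual(1) by (simp add: K_def)
  also have "(LINT x|half_line. K x * \<psi> x) = (LINT x|half_line. \<bar>f x\<bar> * half_conv J \<psi> x)"
    using dual(3) by (simp add: K_def)
  also have "(LINT x|half_line. \<bar>R x\<bar> * \<psi> x) \<le> C * weighted_L1_norm R"
    using weighted_pairing_le[OF in_weighted_L1_abs[OF R] \<psi> \<psi>_AE] by (simp add: weighted_L1_norm_def)
  also have "(1 - h) * (LINT x|half_line. \<bar>f x\<bar> * \<psi> x) + h * (LINT x|half_line. \<bar>f x\<bar> * half_conv J \<psi> x)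
      = (LINT x|half_line. \<bar>f x\<bar> * \<psi> x) - h * (LINT x|half_line. \<bar>f x\<bar> * (\<psi> x - half_conv J \<psi> x))"
    using pair[OF f] dual(2) by (simp add: right_diff_distrib algebra_simps)
  finally show ?thesis
    by (simp add: R_def[abs_def])
qed

text \<open>By duality the generator is orthogonal to a harmonic function, so that only the error of the Euler
  step contributes.\<close>

lemma euler_step_harmonic:
  assumes f: "in_weighted_L1 f" and g: "in_weighted_L1 g"
    and \<psi>: "\<psi> \<in> borel_measurable half_line"
    and "C \<ge> 0" and \<psi>_le: "AE x in half_line. \<bar>\<psi> x\<bar> \<le> C * (1 + x)"
    and harmonic: "\<And>x. x > 0 \<Longrightarrow> half_conv J \<psi> x = \<psi> x"
  shows "\<bar>(LINT x|half_line. g x * \<psi> x) - (LINT x|half_line. f x * \<psi> x)\<bar>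
    \<le> C * weighted_L1_norm (\<lambda>x. g x - f x - h * generator f x)"
proof -
  define R where "R x = g x - f x - h * generator f x" for x
  have R: "in_weighted_L1 R"
    unfolding R_def using in_weighted_L1_lincomb[OF in_weighted_L1_generator[OF f] f, of h 0] f g
    by (intro in_weighted_L1_diff) auto
  note dual = half_conv_duality[OF f \<psi> \<open>C \<ge> 0\<close> \<psi>_le]
  note pair = integrable_weighted_pairing[OF _ \<psi> \<psi>_le]
  have "(LINT x|half_line. f x * half_conv J \<psi> x) = (LINT x|half_line. f x * \<psi> x)"
    using harmonic by (intro Bochner_Integration.integral_cong) auto
  then have invariant: "(LINT x|half_line. half_conv J f x * \<psi> x) = (LINT x|half_line. f x * \<psi> x)"
    using dual(3) by simp
  have "(LINT x|half_line. R x * \<psi> x)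
      = (LINT x|half_line. g x * \<psi> x - f x * \<psi> x - h * (half_conv J f x * \<psi> x - f x * \<psi> x))"
    by (intro Bochner_Integration.integral_cong) (auto simp: R_def generator_def algebra_simps)
  also have "\<dots> = (LINT x|half_line. g x * \<psi> x) - (LINT x|half_line. f x * \<psi> x)"
    using pair[OF f] pair[OF g] dual(1) invariant by simp
  finally show ?thesis
    using weighted_pairing_le[OF R \<psi> \<psi>_le] by (simp add: R_def[abs_def])
qed

end

context half_line_evolution
begin

text \<open>Dissipation: a supersolution is a Lyapunov function, and its pairing with \<open>\<bar>u\<bar>\<close> decreases at least
  at the rate at which the defect \<open>\<psi> - half_conv J \<psi>\<close> is charged by \<open>\<bar>u\<bar>\<close>.\<close>

lemma supersolution_pairing_decay:
  assumes "0 < s" "s \<le> T"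
    and \<psi>: "\<psi> \<in> borel_measurable half_line"
    and \<psi>_nonneg: "\<And>x. x > 0 \<Longrightarrow> \<psi> x \<ge> 0"
    and "C > 0" and \<psi>_le: "\<And>x. x > 0 \<Longrightarrow> \<psi> x \<le> C * (1 + x)"
    and rate: "\<And>t. s \<le> t \<Longrightarrow> t \<le> T \<Longrightarrow> r \<le> (LINT x|half_line. \<bar>u x t\<bar> * (\<psi> x - half_conv J \<psi> x))"
  shows "(LINT x|half_line. \<bar>u x T\<bar> * \<psi> x) \<le> (LINT x|half_line. \<bar>u x s\<bar> * \<psi> x) - r * (T - s)"
proof -
  define P where "P t = (LINT x|half_line. \<bar>u x t\<bar> * \<psi> x)" for t
  have "P T - P s \<le> (- r) * (T - s)"
    using \<open>s \<le> T\<close>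
  proof (rule increment_bound_from_local)
    fix c e :: real
    assume "s \<le> c" "c \<le> T" "e > 0"
    obtain \<delta> where "\<delta> > 0" and \<delta>: "\<And>a b. 0 < a \<Longrightarrow> a \<le> c \<Longrightarrow> c \<le> b \<Longrightarrow> b - a < \<delta> \<Longrightarrow>
        weighted_L1_norm (\<lambda>x. u x b - u x a - (b - a) * generator (\<lambda>y. u y a) x) \<le> e / C * (b - a)"
      using euler_step[of c "e / C"] \<open>0 < s\<close> \<open>s \<le> c\<close> \<open>e > 0\<close> \<open>C > 0\<close> by auto
    have "P b - P a \<le> (- r + e) * (b - a)"
      if ab: "s \<le> a" "a \<le> c" "c \<le> b" "b \<le> T" "b - a < min \<delta> 1" for a b
    proof -
      have "P b \<le> P a - (b - a) * (LINT x|half_line. \<bar>u x a\<bar> * (\<psi> x - half_conv J \<psi> x))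
          + C * weighted_L1_norm (\<lambda>x. u x b - u x a - (b - a) * generator (\<lambda>y. u y a) x)"
        unfolding P_def using ab \<open>0 < s\<close> \<open>C > 0\<close>
        by (intro euler_step_supersolution u_in \<psi> \<psi>_nonneg \<psi>_le) auto
      moreover have "(b - a) * r \<le> (b - a) * (LINT x|half_line. \<bar>u x a\<bar> * (\<psi> x - half_conv J \<psi> x))"
        using ab by (intro mult_left_mono rate) auto
      moreover have "C * weighted_L1_norm (\<lambda>x. u x b - u x a - (b - a) * generator (\<lambda>y. u y a) x)
          \<le> C * (e / C * (b - a))"
        using ab \<open>0 < s\<close> \<open>C > 0\<close> by (intro mult_left_mono \<delta>) auto
      moreover have "C * (e / C * (b - a)) = e * (b - a)"
        using \<open>C > 0\<close> by simp
      moreover have "(- r + e) * (b - a) = e * (b - a) - (b - a) * r"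
        by (simp add: algebra_simps)
      ultimately show ?thesis
        by linarith
    qed
    then show "\<exists>\<delta>>0. \<forall>a b. s \<le> a \<longrightarrow> a \<le> c \<longrightarrow> c \<le> b \<longrightarrow> b \<le> T \<longrightarrow> b - a < \<delta> \<longrightarrow>
        P b - P a \<le> (- r + e) * (b - a)"
      using \<open>\<delta> > 0\<close> by (intro exI[of _ "min \<delta> 1"]) auto
  qed
  then show ?thesis
    by (simp add: P_def)
qed

corollary supersolution_pairing_antimono:
  assumes "0 < s" "s \<le> T"
    and \<psi>: "\<psi> \<in> borel_measurable half_line"
    and \<psi>_nonneg: "\<And>x. x > 0 \<Longrightarrow> \<psi> x \<ge> 0"
    and "C > 0" and \<psi>_le: "\<And>x. x > 0 \<Longrightarrow> \<psi> x \<le> C * (1 + x)"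
    and super: "\<And>x. x > 0 \<Longrightarrow> half_conv J \<psi> x \<le> \<psi> x"
  shows "(LINT x|half_line. \<bar>u x T\<bar> * \<psi> x) \<le> (LINT x|half_line. \<bar>u x s\<bar> * \<psi> x)"
proof -
  have "0 \<le> (LINT x|half_line. \<bar>u x t\<bar> * (\<psi> x - half_conv J \<psi> x))" for t
    using super by (intro integral_nonneg_AE AE_I2) auto
  then show ?thesis
    using supersolution_pairing_decay[of s T \<psi> C 0] assms by simp
qed

text \<open>The pairing is constant for positive times; continuity in the weighted norm extends this to the
  initial time, at which the differential equation is not available.\<close>

lemma harmonic_pairing_constant:
  assumes \<psi>: "\<psi> \<in> borel_measurable half_line"
    and "C > 0" and \<psi>_le: "AE x in half_line. \<bar>\<psi> x\<bar> \<le> C * (1 + x)"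
    and harmonic: "\<And>x. x > 0 \<Longrightarrow> half_conv J \<psi> x = \<psi> x"
    and "T > 0"
  shows "(LINT x|half_line. u x T * \<psi> x) = (LINT x|half_line. u x 0 * \<psi> x)"
proof -
  define m where "m t = (LINT x|half_line. u x t * \<psi> x)" for t
  have step: "\<bar>m b - m a\<bar> \<le> C * weighted_L1_norm (\<lambda>x. u x b - u x a - h * generator (\<lambda>y. u y a) x)"
    if "a \<ge> 0" "b \<ge> 0" for a b h
    unfolding m_def using that \<open>C > 0\<close> by (intro euler_step_harmonic u_in \<psi> \<psi>_le harmonic) auto
  have m_eq: "m T = m s" if "0 < s" "s \<le> T" for s
  proof -
    \<comment> \<open>The two signs \<open>\<sigma>\<close> give the two inequalities that make up constancy.\<close>
    have "\<sigma> * m T - \<sigma> * m s \<le> 0 * (T - s)" if "\<bar>\<sigma>\<bar> = 1" for \<sigma> :: real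
      using \<open>s \<le> T\<close>
    proof (rule increment_bound_from_local)
      fix c e :: real
      assume "s \<le> c" "c \<le> T" "e > 0"
      obtain \<delta> where "\<delta> > 0" and \<delta>: "\<And>a b. 0 < a \<Longrightarrow> a \<le> c \<Longrightarrow> c \<le> b \<Longrightarrow> b - a < \<delta> \<Longrightarrow>
          weighted_L1_norm (\<lambda>x. u x b - u x a - (b - a) * generator (\<lambda>y. u y a) x) \<le> e / C * (b - a)"
        using euler_step[of c "e / C"] \<open>0 < s\<close> \<open>s \<le> c\<close> \<open>e > 0\<close> \<open>C > 0\<close> by auto
      have "\<sigma> * m b - \<sigma> * m a \<le> (0 + e) * (b - a)"
        if ab: "s \<le> a" "a \<le> c" "c \<le> b" "b \<le> T" "b - a < \<delta>" for a b
      proof -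
        have "\<sigma> * m b - \<sigma> * m a \<le> \<bar>\<sigma> * (m b - m a)\<bar>"
          by (simp add: right_diff_distrib)
        also have "\<dots> = \<bar>m b - m a\<bar>"
          using \<open>\<bar>\<sigma>\<bar> = 1\<close> by (simp add: abs_mult)
        also have "\<dots> \<le> C * weighted_L1_norm (\<lambda>x. u x b - u x a - (b - a) * generator (\<lambda>y. u y a) x)"
          using ab \<open>0 < s\<close> by (intro step) auto
        also have "\<dots> \<le> C * (e / C * (b - a))"
          using ab \<open>0 < s\<close> \<open>C > 0\<close> by (intro mult_left_mono \<delta>) auto
        finally show ?thesis
          using \<open>C > 0\<close> by simp
      qed
      then show "\<exists>\<delta>>0. \<forall>a b. s \<le> a \<longrightarrow> a \<le> c \<longrightarrow> c \<le> b \<longrightarrow> b \<le> T \<longrightarrow> b - a < \<delta> \<longrightarrow>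
          \<sigma> * m b - \<sigma> * m a \<le> (0 + e) * (b - a)"
        using \<open>\<delta> > 0\<close> by blast
    qed
    from this[of 1] this[of "-1"] show ?thesis
      by simp
  qed
  have "\<bar>m T - m 0\<bar> \<le> 0"
  proof (rule field_le_epsilon)
    fix e :: real
    assume "e > 0"
    then obtain \<delta> where "\<delta> > 0"
      and \<delta>: "\<And>t. t \<ge> 0 \<Longrightarrow> \<bar>t - 0\<bar> < \<delta> \<Longrightarrow> weighted_L1_norm (\<lambda>x. u x t - u x 0) < e / C"
      using u_norm_continuous[of 0 "e / C"] \<open>C > 0\<close> by auto
    define s where "s = min (\<delta> / 2) T"
    have s: "0 < s" "s \<le> T" "s < \<delta>"
      using \<open>\<delta> > 0\<close> \<open>T > 0\<close> by (auto simp: s_def)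
    have "\<bar>m T - m 0\<bar> = \<bar>m s - m 0\<bar>"
      using m_eq s by simp
    also have "\<dots> \<le> C * weighted_L1_norm (\<lambda>x. u x s - u x 0)"
      using step[of 0 s 0] s by simp
    also have "\<dots> \<le> C * (e / C)"
      using \<delta>[of s] s \<open>C > 0\<close> by (intro mult_left_mono) auto
    finally show "\<bar>m T - m 0\<bar> \<le> 0 + e"
      using \<open>C > 0\<close> by simp
  qed
  then show ?thesis
    by (simp add: m_def)
qed

section \<open>Decay of the mass\<close>

lemma integrable_u:
  assumes "t \<ge> 0"
  shows "integrable half_line (\<lambda>x. \<bar>u x t\<bar>)"
    and "integrable half_line (\<lambda>x. \<bar>u x t\<bar> * (x + d))"
proof -
  note au = in_weighted_L1_abs[OF u_in[OF assms]]
  have "integrable half_line (\<lambda>x. \<bar>u x t\<bar> * 1)"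
    by (rule integrable_weighted_pairing[OF au, where C = 1]) (auto intro!: AE_I2)
  then show "integrable half_line (\<lambda>x. \<bar>u x t\<bar>)"
    by simp
  show "integrable half_line (\<lambda>x. \<bar>u x t\<bar> * (x + d))"
    by (rule integrable_weighted_pairing[OF au, where C = "1 + d"])
       (use d_pos in \<open>auto intro!: AE_I2 borel_measurable_half_line simp: algebra_simps\<close>)
qed

lemma mass_antimono:
  assumes "0 < s" "s \<le> t"
  shows "(LINT x|half_line. \<bar>u x t\<bar>) \<le> (LINT x|half_line. \<bar>u x s\<bar>)"
  using supersolution_pairing_antimono[of s t "\<lambda>_. 1" 1] half_conv_one_le assms by simp

lemma first_moment_antimono:
  assumes "0 < s" "s \<le> t"
  shows "(LINT x|half_line. \<bar>u x t\<bar> * (x + d)) \<le> (LINT x|half_line. \<bar>u x s\<bar> * (x + d))"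
proof (rule supersolution_pairing_antimono[where C = "1 + d"])
  show "half_conv J (\<lambda>x. x + d) x \<le> x + d" if "x > 0" for x
    using half_conv_affine_le[OF that order_refl] .
  show "x + d \<le> (1 + d) * (1 + x)" if "x > 0" for x
    using that d_pos by (simp add: algebra_simps)
  show "(\<lambda>x. x + d) \<in> borel_measurable half_line"
    by (rule borel_measurable_half_line) measurable
qed (use assms d_pos in auto)

text \<open>If the mass stayed above \<open>\<epsilon>\<close>, the bounded first moment would confine at least half of it to a fixed
  interval \<open>(0, R)\<close>.  A bounded concave function, strictly concave on that interval, would then be
  a Lyapunov function that decreases at a fixed positive rate, although it is nonnegative.\<close>

lemma mass_small:
  assumes "\<epsilon> > 0"
  shows "\<exists>t\<ge>1. (LINT x|half_line. \<bar>u x t\<bar>) < \<epsilon>"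
proof (rule ccontr)
  assume "\<not> ?thesis"
  then have mass_ge: "(LINT x|half_line. \<bar>u x t\<bar>) \<ge> \<epsilon>" if "t \<ge> 1" for t
    using that by force
  define V where "V = (LINT x|half_line. \<bar>u x 1\<bar> * (x + d))"
  have "V \<ge> 0"
    unfolding V_def using d_pos by (intro integral_nonneg_AE AE_I2) auto
  define R where "R = 2 * V / \<epsilon> + 1"
  have "R > 0" and V_le: "V / R \<le> \<epsilon> / 2"
    using \<open>V \<ge> 0\<close> \<open>\<epsilon> > 0\<close> by (simp_all add: R_def field_simps add_pos_nonneg)
  \<comment> \<open>A parabola up to its vertex at \<open>R + d\<close>, constant afterwards, and zero at \<open>- d\<close>.  The vertex lies \<open>d\<close>
  beyond \<open>R\<close>, so from any point up to \<open>R\<close> the kernel sees only the parabola.\<close>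
  define \<psi> where "\<psi> x = (R + 2 * d)\<^sup>2 - (max 0 (R + d - x))\<^sup>2" for x
  define C where "C = (R + 2 * d)\<^sup>2"
  have "C > 0"
    using \<open>R > 0\<close> d_pos by (simp add: C_def)
  have \<psi>_meas: "\<psi> \<in> borel_measurable half_line"
    unfolding \<psi>_def by (intro borel_measurable_half_line) measurable
  have \<psi>_nonneg: "\<psi> x \<ge> 0" if "x > - d" for x
    unfolding \<psi>_def using that \<open>R > 0\<close> d_pos by (simp add: power_mono)
  have \<psi>_le: "\<psi> x \<le> C * (1 + x)" if "x > 0" for x
  proof -
    have "\<psi> x \<le> C * 1"
      by (simp add: \<psi>_def C_def)
    also have "\<dots> \<le> C * (1 + x)"
      using \<open>C > 0\<close> that by (intro mult_left_mono) auto
    finally show ?thesis .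
  qed
  \<comment> \<open>The defect of \<open>\<psi>\<close> is at least the second moment up to \<open>R\<close> and nonnegative beyond.  An affine
  function below the indicator of \<open>{..R}\<close> makes the two quantities already under control appear:
  the mass and the first moment.\<close>
  have drop: "second_moment * (1 - (x + d) / R) \<le> \<psi> x - half_conv J \<psi> x" if "x > 0" for x
  proof (cases "x \<le> R")
    case True
    have "half_conv J \<psi> x \<le> \<psi> x - 1 * second_moment"
    proof (rule half_conv_supersolution[OF \<open>x > 0\<close> \<psi>_nonneg])
      fix z :: real
      assume "\<bar>z\<bar> < d"
      with True have "max 0 (R + d - x) = R + d - x" "max 0 (R + d - (x + z)) = R + d - x - z"
        by auto
      then show "\<psi> (x + z) \<le> \<psi> x + 2 * (R + d - x) * z - 1 * z\<^sup>2"
        unfolding \<psi>_def by (simp add: power2_eq_square algebra_simps)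
    qed auto
    moreover have "second_moment * (1 - (x + d) / R) \<le> second_moment * 1"
      using second_moment_pos \<open>x > 0\<close> d_pos \<open>R > 0\<close> by (intro mult_left_mono) auto
    ultimately show ?thesis
      by simp
  next
    case False
    have "half_conv J \<psi> x \<le> \<psi> x - 0 * second_moment"
    proof (rule half_conv_supersolution[OF \<open>x > 0\<close> \<psi>_nonneg])
      fix z :: real
      define m where "m = max 0 (R + d - x)"
      have "m * m - 2 * m * z \<le> (max 0 (R + d - (x + z)))\<^sup>2"
      proof (cases "m \<le> z \<or> m = 0")
        case True
        then have "m * (m - 2 * z) \<le> 0"
          by (auto simp: m_def mult_nonneg_nonpos)
        also have "m * (m - 2 * z) = m * m - 2 * m * z"
          by (simp add: algebra_simps)
        finally show ?thesis
          by (rule order_trans) simp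
      next
        case False
        then have eq: "max 0 (R + d - (x + z)) = m - z"
          by (auto simp: m_def)
        have "m * m - 2 * m * z \<le> (m - z)\<^sup>2"
          by (simp add: power2_eq_square algebra_simps)
        then show ?thesis
          by (simp only: eq)
      qed
      then show "\<psi> (x + z) \<le> \<psi> x + 2 * m * z - 0 * z\<^sup>2"
        unfolding \<psi>_def by (simp add: m_def[symmetric] power2_eq_square)
    qed auto
    moreover have "1 - (x + d) / R \<le> 0"
      using False \<open>R > 0\<close> d_pos by (simp add: field_simps)
    then have "second_moment * (1 - (x + d) / R) \<le> 0"
      using second_moment_pos by (simp add: mult_nonneg_nonpos)
    ultimately show ?thesis
      by simp
  qed
  define r where "r = second_moment * (\<epsilon> / 2)"
  have "r > 0"
    using second_moment_pos \<open>\<epsilon> > 0\<close> by (simp add: r_def)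
  have rate: "r \<le> (LINT x|half_line. \<bar>u x t\<bar> * (\<psi> x - half_conv J \<psi> x))" if "t \<ge> 1" for t
  proof -
    have t: "t \<ge> 0"
      using that by simp
    have "(LINT x|half_line. \<bar>u x t\<bar> * (x + d)) / R \<le> V / R"
      using first_moment_antimono[of 1 t] that \<open>R > 0\<close> by (simp add: V_def divide_right_mono)
    then have "\<epsilon> / 2 \<le> (LINT x|half_line. \<bar>u x t\<bar>) - (LINT x|half_line. \<bar>u x t\<bar> * (x + d)) / R"
      using mass_ge[OF that] V_le by linarith
    then have "r \<le> second_moment * ((LINT x|half_line. \<bar>u x t\<bar>) - (LINT x|half_line. \<bar>u x t\<bar> * (x + d)) / R)"
      using second_moment_pos by (simp add: r_def)
    also have "\<dots> = (LINT x|half_line. second_moment * (\<bar>u x t\<bar> - \<bar>u x t\<bar> * (x + d) / R))"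
      using integrable_u[OF t] by simp
    also have "\<dots> \<le> (LINT x|half_line. \<bar>u x t\<bar> * (\<psi> x - half_conv J \<psi> x))"
    proof (rule integral_mono)
      show "integrable half_line (\<lambda>x. second_moment * (\<bar>u x t\<bar> - \<bar>u x t\<bar> * (x + d) / R))"
        using integrable_u[OF t] by simp
      have \<psi>_AE: "AE x in half_line. \<bar>\<psi> x\<bar> \<le> C * (1 + x)"
        using \<psi>_nonneg \<psi>_le d_pos by (intro AE_I2) auto
      note au = in_weighted_L1_abs[OF u_in[OF t]]
      have "integrable half_line (\<lambda>x. \<bar>u x t\<bar> * \<psi> x - \<bar>u x t\<bar> * half_conv J \<psi> x)"
        using integrable_weighted_pairing[OF au \<psi>_meas \<psi>_AE]
          half_conv_duality(2)[OF au \<psi>_meas _ \<psi>_AE] \<open>C > 0\<close> by auto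
      then show "integrable half_line (\<lambda>x. \<bar>u x t\<bar> * (\<psi> x - half_conv J \<psi> x))"
        by (simp add: right_diff_distrib)
      fix x :: real
      assume "x \<in> space half_line"
      then have "\<bar>u x t\<bar> * (second_moment * (1 - (x + d) / R)) \<le> \<bar>u x t\<bar> * (\<psi> x - half_conv J \<psi> x)"
        by (intro mult_left_mono drop) auto
      then show "second_moment * (\<bar>u x t\<bar> - \<bar>u x t\<bar> * (x + d) / R) \<le> \<bar>u x t\<bar> * (\<psi> x - half_conv J \<psi> x)"
        by (simp add: algebra_simps)
    qed
    finally show ?thesis .
  qed
  define P where "P t = (LINT x|half_line. \<bar>u x t\<bar> * \<psi> x)" for t
  have P_nonneg: "P t \<ge> 0" for t
    unfolding P_def using \<psi>_nonneg d_pos by (intro integral_nonneg_AE AE_I2) auto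
  define T where "T = 1 + (P 1 + 1) / r"
  have "T \<ge> 1"
    using P_nonneg[of 1] \<open>r > 0\<close> by (simp add: T_def)
  have "P T \<le> P 1 - r * (T - 1)"
    unfolding P_def using \<open>T \<ge> 1\<close> \<open>C > 0\<close> d_pos
    by (intro supersolution_pairing_decay[where C = C] \<psi>_meas \<psi>_nonneg \<psi>_le rate) auto
  also have "\<dots> = - 1"
    using \<open>r > 0\<close> by (simp add: T_def)
  finally show False
    using P_nonneg[of T] by simp
qed

lemma mass_tendsto_0: "((\<lambda>t. LINT x|half_line. \<bar>u x t\<bar>) \<longlongrightarrow> 0) at_top"
proof (rule tendstoI)
  fix \<epsilon> :: real
  assume "\<epsilon> > 0"
  then obtain t0 where "t0 \<ge> 1" and t0: "(LINT x|half_line. \<bar>u x t0\<bar>) < \<epsilon>"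
    using mass_small by blast
  have "dist (LINT x|half_line. \<bar>u x t\<bar>) 0 < \<epsilon>" if "t \<ge> t0" for t
    using mass_antimono[of t0 t] t0 that \<open>t0 \<ge> 1\<close> by (simp add: abs_of_nonneg)
  then show "eventually (\<lambda>t. dist (LINT x|half_line. \<bar>u x t\<bar>) 0 < \<epsilon>) at_top"
    by (rule eventually_at_top_linorderI)
qed

end

section \<open>Convergence of the first moment\<close>

text \<open>Both convolutions of the problem reduce to the half line in this way: a solution vanishes at
  almost every negative point, and \<open>\<phi>\<close> at every negative point within reach of the kernel.\<close>

lemma conv_eq_half_conv:
  assumes "f \<in> borel_measurable half_line" "J \<in> borel_measurable borel"
    and vanish: "AE y in lebesgue. y < 0 \<longrightarrow> J (x - y) * f y = 0"
  shows "conv J f x = half_conv J f x"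
proof -
  define g where "g y = (if y \<in> {0<..} then J (x - y) * f y else 0)" for y
  note assms(2) [measurable]
  have "(\<lambda>y. J (x - y) * f y) \<in> borel_measurable half_line"
    by (intro borel_measurable_times assms(1) borel_measurable_half_line) measurable
  then have g: "g \<in> borel_measurable lebesgue"
    unfolding g_def by (intro borel_measurable_if_I) auto
  have "AE y in lebesgue. y \<noteq> (0::real)"
    by (intro AE_completion AE_lborel_singleton)
  with vanish have eq: "AE y in lebesgue. g y = J (x - y) * f y"
    by eventually_elim (auto simp: g_def)
  have "conv J f x = (LINT y|lebesgue. g y)"
    unfolding conv_def using eq
    by (intro integral_cong_AE borel_measurable_AE[OF g] g) (auto elim!: eventually_mono)
  also have "\<dots> = half_conv J f x"
    unfolding half_conv_def integral_half_line
    by (intro Bochner_Integration.integral_cong) (auto simp: g_def)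
  finally show ?thesis .
qed

lemma stationary_solution_bound:
  assumes "stationary_solution J d \<phi>"
  obtains C where "C \<ge> 0" "AE x in half_line. \<bar>\<phi> x - x\<bar> \<le> C" "\<phi> \<in> borel_measurable half_line"
proof -
  have "in_Linf (\<lambda>x. \<phi> x - x)"
    using assms by (simp add: stationary_solution_def)
  then obtain C where diff [measurable]: "(\<lambda>x. \<phi> x - x) \<in> borel_measurable half_line"
    and C: "AE x in half_line. \<bar>\<phi> x - x\<bar> \<le> C"
    unfolding in_Linf_def by blast
  have "(\<lambda>x. (\<phi> x - x) + x) \<in> borel_measurable half_line"
    by (intro borel_measurable_add diff identity_measurable_half_line)
  then have "\<phi> \<in> borel_measurable half_line"
    by simp
  moreover have "AE x in half_line. \<bar>\<phi> x - x\<bar> \<le> max 0 C"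
    using C by (auto elim!: eventually_mono)
  ultimately show ?thesis
    using that[of "max 0 C"] by auto
qed

theorem proposition3p3:
  fixes J \<phi> u0 :: "real \<Rightarrow> real"
    and u :: "real \<Rightarrow> real \<Rightarrow> real"
    and d :: real
  assumes "d > 0"
    and "smooth_real J"
    and "\<And>z. J z \<ge> 0"
    and "\<And>z. J (- z) = J z"
    and "(LINT z|lebesgue. J z) = 1"
    and "\<And>z. \<bar>z\<bar> \<ge> d \<Longrightarrow> J z = 0"
    and "stationary_solution J d \<phi>"
    and "\<And>x. u0 x \<ge> 0"
    and "bounded (range u0)"
    and "\<And>x. x < 0 \<Longrightarrow> u0 x = 0"
    and "in_weighted_L1 u0"
    and "evolution_solution J u0 u"
  shows "((\<lambda>t. LINT x|half_line. u x t * x) \<longlongrightarrow> (LINT x|half_line. u0 x * \<phi> x)) at_top"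
proof -
  have J_cont: "continuous_on UNIV J"
    using \<open>smooth_real J\<close> unfolding smooth_real_def
    by (metis differentiable_imp_continuous_on funpow_0)
  then have J_meas: "J \<in> borel_measurable borel"
    by (rule borel_measurable_continuous_onI)
  interpret symmetric_kernel J d
  proof
    show "(LINT z|lborel. J z) = 1"
      using \<open>(LINT z|lebesgue. J z) = 1\<close> J_meas by (simp add: integral_completion)
  qed (use assms J_cont in auto)
  note evolution = \<open>evolution_solution J u0 u\<close>[unfolded evolution_solution_def]
  have u_in: "in_weighted_L1 (\<lambda>x. u x t)" if "t \<ge> 0" for t
    using evolution that by (auto simp: continuous_weighted_L1_def)
  have conv_u: "conv J (\<lambda>y. u y t) x = half_conv J (\<lambda>y. u y t) x" if "t > 0" for t x
  proof (rule conv_eq_half_conv[OF in_weighted_L1_measurable[OF u_in] J_meas])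
    have "AE y in lebesgue. y < 0 \<longrightarrow> (\<forall>t>0. u y t = 0)"
      using evolution by blast
    then show "AE y in lebesgue. y < 0 \<longrightarrow> J (x - y) * u y t = 0"
      using that by (auto elim!: eventually_mono)
  qed (use that in simp)
  interpret half_line_evolution J d u
  proof
    show "continuous_weighted_L1 u"
      using evolution by blast
    have "AE x in lebesgue. x \<ge> 0 \<longrightarrow>
        (\<forall>t>0. (u x has_real_derivative (conv J (\<lambda>y. u y t) x - u x t)) (at t))"
      using evolution by blast
    then show "AE x in half_line. \<forall>t>0.
        (u x has_real_derivative (half_conv J (\<lambda>y. u y t) x - u x t)) (at t)"
      unfolding AE_half_line_iff by eventually_elim (auto simp: conv_u)
  qed
  obtain C where "C \<ge> 0" and C: "AE x in half_line. \<bar>\<phi> x - x\<bar> \<le> C"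
    and \<phi>_meas: "\<phi> \<in> borel_measurable half_line"
    using stationary_solution_bound[OF \<open>stationary_solution J d \<phi>\<close>] by blast
  have harmonic: "half_conv J \<phi> x = \<phi> x" if "x > 0" for x
  proof -
    have "conv J \<phi> x = half_conv J \<phi> x"
    proof (rule conv_eq_half_conv[OF \<phi>_meas J_meas], rule AE_I2, rule impI)
      fix y :: real
      assume "y < 0"
      then have "\<phi> y = 0 \<or> J (x - y) = 0"
        using \<open>stationary_solution J d \<phi>\<close> J_support[of "x - y"] that
        by (cases "y > - d") (auto simp: stationary_solution_def)
      then show "J (x - y) * \<phi> y = 0"
        by auto
    qed
    then show ?thesis
      using \<open>stationary_solution J d \<phi>\<close> that by (simp add: stationary_solution_def)
  qed
  have \<phi>_le: "AE x in half_line. \<bar>\<phi> x\<bar> \<le> (C + 1) * (1 + x)"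
  proof -
    have "AE x in half_line. x > 0"
      by (auto intro: AE_I2)
    with C show ?thesis
    proof eventually_elim
      case (elim x)
      then have "C * x \<ge> 0"
        using \<open>C \<ge> 0\<close> by simp
      moreover have "(C + 1) * (1 + x) = C + 1 + x + C * x"
        by (simp add: algebra_simps)
      ultimately show ?case
        using elim by linarith
    qed
  qed
  define M where "M = (LINT x|half_line. u0 x * \<phi> x)"
  have invariant: "(LINT x|half_line. u x t * \<phi> x) = M" if "t > 0" for t
  proof -
    have "AE x in lebesgue. u x 0 = u0 x"
      using evolution by blast
    then have "AE x in half_line. u x 0 * \<phi> x = u0 x * \<phi> x"
      unfolding AE_half_line_iff by (auto elim!: eventually_mono)
    then have "(LINT x|half_line. u x 0 * \<phi> x) = M"
      unfolding M_def
      using \<phi>_meas u_measurable[of 0] in_weighted_L1_measurable[OF \<open>in_weighted_L1 u0\<close>]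
      by (intro integral_cong_AE borel_measurable_times) auto
    then show ?thesis
      using harmonic_pairing_constant[OF \<phi>_meas _ \<phi>_le harmonic that] \<open>C \<ge> 0\<close> by simp
  qed
  have error: "\<bar>(LINT x|half_line. u x t * x) - M\<bar> \<le> C * (LINT x|half_line. \<bar>u x t\<bar>)" if "t > 0" for t
  proof -
    have t: "in_weighted_L1 (\<lambda>x. u x t)"
      using u_in that by simp
    have int_\<phi>: "integrable half_line (\<lambda>x. u x t * \<phi> x)"
      using integrable_weighted_pairing[OF t \<phi>_meas \<phi>_le] .
    have int_x: "integrable half_line (\<lambda>x. u x t * x)"
      by (rule integrable_weighted_pairing[OF t identity_measurable_half_line, where C = 1])
         (auto intro!: AE_I2)
    have "\<bar>(LINT x|half_line. u x t * x) - M\<bar> = \<bar>LINT x|half_line. u x t * x - u x t * \<phi> x\<bar>"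
      using int_\<phi> int_x invariant[OF that] by simp
    also have "\<dots> \<le> (LINT x|half_line. \<bar>u x t * x - u x t * \<phi> x\<bar>)"
      by (rule integral_abs_bound)
    also have "\<dots> \<le> (LINT x|half_line. C * \<bar>u x t\<bar>)"
    proof (rule integral_mono_AE)
      show "AE x in half_line. \<bar>u x t * x - u x t * \<phi> x\<bar> \<le> C * \<bar>u x t\<bar>"
        using C
      proof eventually_elim
        case (elim x)
        have "\<bar>u x t * x - u x t * \<phi> x\<bar> = \<bar>\<phi> x - x\<bar> * \<bar>u x t\<bar>"
          by (metis abs_minus_commute abs_mult mult.commute right_diff_distrib)
        also have "\<dots> \<le> C * \<bar>u x t\<bar>"
          using elim by (rule mult_right_mono) simp
        finally show ?case .
      qed
    qed (use int_\<phi> int_x integrable_u[of t] that in auto)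
    finally show ?thesis
      by simp
  qed
  have "((\<lambda>t. C * (LINT x|half_line. \<bar>u x t\<bar>)) \<longlongrightarrow> 0) at_top"
    using tendsto_mult_right_zero[OF mass_tendsto_0] .
  then have "((\<lambda>t. (LINT x|half_line. u x t * x) - M) \<longlongrightarrow> 0) at_top"
  proof (rule Lim_null_comparison[rotated])
    show "eventually (\<lambda>t. norm ((LINT x|half_line. u x t * x) - M) \<le> C * (LINT x|half_line. \<bar>u x t\<bar>)) at_top"
      using eventually_gt_at_top[of 0] by eventually_elim (simp add: error)
  qed
  then show ?thesis
    using Lim_null[of "\<lambda>t. LINT x|half_line. u x t * x" M at_top] by (simp add: M_def)
qed

end
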